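(* Let $q=2^r$ and let $\psi$ be any nontrivial additive character of $\mathbb{F}_q$. Whenever $\pm$ appears, either $+$ is chosen everywhere (with $n\ge2$ even) or $-$ is chosen everywhere (with $n\ge1$ odd for $DC_1^-$, and $n\ge3$ odd for $DC_2^-$). Then $$\sum_{w\in DC_1^\pm(n,q)}\psi(Tr\,w)=A_1^\pm(n,q)K(\psi;1),$$ and $$\sum_{w\in DC_2^\pm(n,q)}\psi(Tr\,w)=q^{-1}A_2^\pm(n,q)K_{GL(2,q)}(\psi;1)=A_2^\pm(n,q)\bigl(K(\psi;1)^2+q^2-q\bigr).$$
   Context: Let $q=2^r$ and let $\mathbb{F}_q$ be the field with $q$ elements. For a nontrivial additive character $\psi$ of $\mathbb{F}_q$ and $a\in\mathbb{F}_q^*$, define $K(\psi;a)=\sum_{\alpha\in\mathbb{F}_q^*}\psi(\alpha+a\alpha^{-1})$ and $K_{GL(2,q)}(\psi;a)=\sum_{w\in GL(2,q)}\psi(Tr\,w+a\,Tr\,w^{-1})$, where $Tr$ is the matrix trace. $O^+(2n,q)$ is the group of $g\in GL(2n,q)$ preserving $\theta^+(x)=\sum_{i=1}^nx_ix_{n+i}$. $P^+=P^+(2n,q)$ is the subgroup of all products $\begin{bmatrix}A&0\\0&{}^tA^{-1}\end{bmatrix}\begin{bmatrix}1_n&B\\0&1_n\end{bmatrix}$ with $A\in GL(n,q)$ and $B$ an $n\times n$ symmetric matrix with zero diagonal. For $0\le s\le n$, $\sigma_s^+$ is the $2n\times2n$ matrix which, in block form for $2n=s+(n-s)+s+(n-s)$,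 is $\begin{bmatrix}0&0&1_s&0\\0&1_{n-s}&0&0\\1_s&0&0&0\\0&0&0&1_{n-s}\end{bmatrix}$. The double cosets are: - $DC_1^+(n,q)=P^+\sigma_{n-1}^+P^+$ and $DC_2^+(n,q)=P^+\sigma_{n-2}^+P^+$ for even $n\ge2$; - $DC_1^-(n,q)=P^+\sigma_{n-1}^+P^+$ for odd $n\ge1$; - $DC_2^-(n,q)=P^+\sigma_{n-2}^+P^+$ for odd $n\ge3$. With $\left[\begin{smallmatrix}n\\k\end{smallmatrix}\right]_q=\prod_{j=0}^{k-1}\frac{q^{n-j}-1}{q^{k-j}-1}$ and empty products equal to $1$, define: - $A_1^+(n,q)=q^{(5n^2-6n)/4}\left[\begin{smallmatrix}n\\1\end{smallmatrix}\right]_q\prod_{j=1}^{n/2}(q^{2j-1}-1)$; - $A_2^+(n,q)=q^{(5n^2-6n)/4}\left[\begin{smallmatrix}n\\2\end{smallmatrix}\right]_q\prod_{j=1}^{(n-2)/2}(q^{2j-1}-1)$; - $A_1^-(n,q)=q^{(5n^2-4n-1)/4}\left[\begin{smallmatrix}n\\1\end{smallmatrix}\right]_q\prod_{j=1}^{(n-1)/2}(q^{2j-1}-1)$; - $A_2^-(n,q)=q^{(5n^2-8n+3)/4}\left[\begin{smallmatrix}n\\2\end{smallmatrix}\right]_q\prod_{j=1}^{(n-1)/2}(q^{2j-1}-1)$. *)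

theory Defs
  imports Complex_Main "Jordan_Normal_Form.Gauss_Jordan_Elimination"
begin

definition nontrivial_additive_character :: "('a::field \<Rightarrow> complex) \<Rightarrow> bool" where
  "nontrivial_additive_character \<psi> \<longleftrightarrow>
     (\<forall>x y. \<psi> (x + y) = \<psi> x * \<psi> y) \<and> (\<forall>x. \<psi> x \<noteq> 0) \<and> (\<exists>x. \<psi> x \<noteq> 1)"

definition mat_trace :: "'a::comm_monoid_add mat \<Rightarrow> 'a" where
  "mat_trace A = (\<Sum>i<dim_row A. A $$ (i, i))"

definition GL :: "nat \<Rightarrow> 'a::field mat set" where
  "GL n = {A \<in> carrier_mat n n. invertible_mat A}"

(* mat_inverse is option-valued; it is only applied to invertible matrices below. *)
definition mat_inv :: "'a::field mat \<Rightarrow> 'a mat" where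
  "mat_inv A = the (mat_inverse A)"

definition kloosterman :: "('a::{field,finite} \<Rightarrow> complex) \<Rightarrow> 'a \<Rightarrow> complex" where
  "kloosterman \<psi> a = (\<Sum>\<alpha>\<in>UNIV - {0}. \<psi> (\<alpha> + a * inverse \<alpha>))"

definition kloosterman_GL :: "nat \<Rightarrow> ('a::{field,finite} \<Rightarrow> complex) \<Rightarrow> 'a \<Rightarrow> complex" where
  "kloosterman_GL t \<psi> a = (\<Sum>w\<in>GL t. \<psi> (mat_trace w + a * mat_trace (mat_inv w)))"

definition P_plus :: "nat \<Rightarrow> 'a::field mat set" where
  "P_plus n =
     {four_block_mat A (0\<^sub>m n n) (0\<^sub>m n n) (transpose_mat (mat_inv A)) *
      four_block_mat (1\<^sub>m n) B (0\<^sub>m n n) (1\<^sub>m n) | A B.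
        A \<in> GL n \<and> B \<in> carrier_mat n n \<and> transpose_mat B = B \<and> (\<forall>i<n. B $$ (i, i) = 0)}"

(* The 4 x 4 block matrix with block sizes s, n-s, s, n-s, grouped into four n x n blocks. *)
definition sigma_plus :: "nat \<Rightarrow> nat \<Rightarrow> 'a::field mat" where
  "sigma_plus n s =
     (let D = four_block_mat (0\<^sub>m s s) (0\<^sub>m s (n - s)) (0\<^sub>m (n - s) s) (1\<^sub>m (n - s));
          E = four_block_mat (1\<^sub>m s) (0\<^sub>m s (n - s)) (0\<^sub>m (n - s) s) (0\<^sub>m (n - s) (n - s))
      in four_block_mat D E E D)"

definition P_double_coset :: "nat \<Rightarrow> nat \<Rightarrow> 'a::field mat set" where
  "P_double_coset n s = {p * sigma_plus n s * p' | p p'. p \<in> P_plus n \<and> p' \<in> P_plus n}"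

(* The sign records the parity of n: plus for even n, minus for odd n. *)

definition DC1_plus :: "nat \<Rightarrow> 'a::field mat set" where
  "DC1_plus n = P_double_coset n (n - 1)"

definition DC2_plus :: "nat \<Rightarrow> 'a::field mat set" where
  "DC2_plus n = P_double_coset n (n - 2)"

definition DC1_minus :: "nat \<Rightarrow> 'a::field mat set" where
  "DC1_minus n = P_double_coset n (n - 1)"

definition DC2_minus :: "nat \<Rightarrow> 'a::field mat set" where
  "DC2_minus n = P_double_coset n (n - 2)"

definition gauss_binomial :: "nat \<Rightarrow> nat \<Rightarrow> nat \<Rightarrow> real" where
  "gauss_binomial q n k = (\<Prod>j<k. (real q ^ (n - j) - 1) / (real q ^ (k - j) - 1))"

definition A1_plus :: "nat \<Rightarrow> nat \<Rightarrow> real" where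
  "A1_plus n q = real q powr ((5 * real n ^ 2 - 6 * real n) / 4) * gauss_binomial q n 1 *
     (\<Prod>j = 1..n div 2. (real q ^ (2 * j - 1) - 1))"

definition A2_plus :: "nat \<Rightarrow> nat \<Rightarrow> real" where
  "A2_plus n q = real q powr ((5 * real n ^ 2 - 6 * real n) / 4) * gauss_binomial q n 2 *
     (\<Prod>j = 1..(n - 2) div 2. (real q ^ (2 * j - 1) - 1))"

definition A1_minus :: "nat \<Rightarrow> nat \<Rightarrow> real" where
  "A1_minus n q = real q powr ((5 * real n ^ 2 - 4 * real n - 1) / 4) * gauss_binomial q n 1 *
     (\<Prod>j = 1..(n - 1) div 2. (real q ^ (2 * j - 1) - 1))"

definition A2_minus :: "nat \<Rightarrow> nat \<Rightarrow> real" where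
  "A2_minus n q = real q powr ((5 * real n ^ 2 - 8 * real n + 3) / 4) * gauss_binomial q n 2 *
     (\<Prod>j = 1..(n - 1) div 2. (real q ^ (2 * j - 1) - 1))"

end

theory Submission
  imports Defs "Jordan_Normal_Form.Determinant" "HOL-Algebra.Coset"
begin

text \<open>
  The trace is a class function, so the sum over $P \sigma P$ is $|P| / |P \cap \sigma P \sigma|$ times
  the sum of $\psi(Tr(\sigma p))$ over $p \in P$. Writing $p$ in terms of $A \in GL(n,q)$ and an alternating
  matrix $B$, the sum over $B$ is a complete character sum that vanishes unless the first $s$ rows of $A$
  have the form $(A_1, 0)$ with $A_1$ symmetric. What remains is the Kloosterman sum over
  $GL(n-s,q)$ times the number of invertible symmetric $s \times s$ matrices. That number
  satisfies a two-term recursion in $s$, obtained by sorting the matrices by their first column and passing to a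
  Schur complement. The Kloosterman sum over $GL(2,q)$ is evaluated by summing over the
  diagonal entries and the determinant.
\<close>

section \<open>Sums over double cosets, and invertible matrices\<close>

text \<open>Write n = s + k. The index |P| / |P \<inter> \<sigma>P\<sigma>| is the Gaussian
  binomial, which comes from A, times q^(s(s-1)/2), which comes from B. The sum over B contributes
  q^(n(n-1)/2), the number of alternating matrices, and the lower left block of A, on which nothing
  depends, contributes q^(sk). Together with the power of q in the number of invertible symmetric
  matrices these give the exponents in \<open>A1_plus\<close> and its companions, which are integers
  only for n of the stated parity. The sum over B detects symmetry because in characteristic 2 the
  alternating matrices are exactly the matrices C + C^t, so their annihilator under the pairing
  tr(MB) is the space of symmetric matrices. The obstacle is that P is given by a parametrisation,
  which makes products and the condition \<sigma>p\<sigma> \<in> P awkward. Therefore P is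
  recognised as the subset of the orthogonal group with vanishing lower left block; membership then
  becomes a condition on one block.\<close>

lemma (in group) sum_double_coset:
  fixes f :: "'a \<Rightarrow> 'c::comm_semiring_1"
  assumes P: "subgroup P G" "finite P" and s: "s \<in> carrier G"
    and f: "\<And>x y. x \<in> carrier G \<Longrightarrow> y \<in> carrier G \<Longrightarrow> f (x \<otimes> y) = f (y \<otimes> x)"
  shows "of_nat (card {h \<in> P. inv s \<otimes> h \<otimes> s \<in> P}) * (\<Sum>w\<in>(\<lambda>(p, p'). p \<otimes> s \<otimes> p') ` (P \<times> P). f w)
    = of_nat (card P) * (\<Sum>p\<in>P. f (s \<otimes> p))"
proof -
  define g where "g = (\<lambda>(p, p'). p \<otimes> s \<otimes> p')"
  define H where "H = {h \<in> P. inv s \<otimes> h \<otimes> s \<in> P}"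
  interpret P: subgroup P G by (rule P)
  note c = P.mem_carrier s
  have canc: "inv x \<otimes> (x \<otimes> y) = y" "x \<otimes> (inv x \<otimes> y) = y"
    if "x \<in> carrier G" "y \<in> carrier G" for x y
    using that by (simp_all add: m_assoc[symmetric])
  \<comment> \<open>The pairs over w form a torsor under H = P \<inter> sPs^-1: starting from one
    pair (a, b), the element h yields (ah, s^-1 h^-1 s b), and h is recovered as a^-1 p. Hence all
    fibres have the same size.\<close>
  have fibre: "card {x \<in> P \<times> P. g x = w} = card H" if "w \<in> g ` (P \<times> P)" for w
  proof -
    obtain a b where ab: "a \<in> P" "b \<in> P" "w = a \<otimes> s \<otimes> b" using \<open>w \<in> _\<close> by (auto simp: g_def)
    have "bij_betw (\<lambda>h. (a \<otimes> h, inv s \<otimes> inv h \<otimes> s \<otimes> b)) H {x \<in> P \<times> P. g x = w}"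
    proof (rule bij_betw_byWitness[where f' = "\<lambda>(p, p'). inv a \<otimes> p"], goal_cases)
      case 1
      show ?case using ab by (simp add: H_def c canc)
    next
      case 2
      have "inv s \<otimes> inv (inv a \<otimes> p) \<otimes> s \<otimes> b = p'"
        if "p \<in> P" "p' \<in> P" "p \<otimes> s \<otimes> p' = a \<otimes> s \<otimes> b" for p p'
      proof -
        have "inv s \<otimes> inv (inv a \<otimes> p) \<otimes> s \<otimes> b = inv s \<otimes> inv p \<otimes> (a \<otimes> s \<otimes> b)"
          using that ab by (simp add: c inv_mult_group m_assoc)
        also have "\<dots> = inv s \<otimes> inv p \<otimes> (p \<otimes> s \<otimes> p')" using that by simp
        also have "\<dots> = p'" using that(1,2)
          by (simp add: c m_assoc canc)
        finally show ?thesis .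
      qed
      then show ?case using ab by (simp add: g_def c canc split_paired_all)
    next
      case 3
      have "inv s \<otimes> inv h \<otimes> s \<in> P" if "h \<in> H" for h
      proof -
        have "inv s \<otimes> inv h \<otimes> s = inv (inv s \<otimes> h \<otimes> s)"
          using that by (simp add: H_def c inv_mult_group m_assoc)
        then show ?thesis using that by (auto simp: H_def)
      qed
      moreover have "a \<otimes> h \<otimes> s \<otimes> (inv s \<otimes> inv h \<otimes> s \<otimes> b) = w" if "h \<in> H" for h
        using that ab by (simp add: H_def c m_assoc canc)
      ultimately show ?case using ab by (auto simp: g_def H_def)
    next
      case 4
      have "inv s \<otimes> (inv a \<otimes> p) \<otimes> s = b \<otimes> inv p'"
        if "p \<in> P" "p' \<in> P" "p \<otimes> s \<otimes> p' = a \<otimes> s \<otimes> b" for p p'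
      proof -
        have "inv s \<otimes> (inv a \<otimes> p) \<otimes> s = inv s \<otimes> inv a \<otimes> (p \<otimes> s \<otimes> p') \<otimes> inv p'"
          using that(1,2) ab(1) by (simp add: c m_assoc)
        also have "\<dots> = b \<otimes> inv p'" using that ab
          by (simp add: c m_assoc canc)
        finally show ?thesis .
      qed
      then have "inv s \<otimes> (inv a \<otimes> p) \<otimes> s \<in> P"
        if "p \<in> P" "p' \<in> P" "p \<otimes> s \<otimes> p' = a \<otimes> s \<otimes> b" for p p'
        using that ab by (metis P.m_closed P.m_inv_closed)
      then show ?case using ab by (simp add: g_def H_def image_subset_iff split_paired_all) blast
    qed
    then show ?thesis by (simp add: bij_betw_same_card)
  qed
  have "of_nat (card H) * (\<Sum>w\<in>g ` (P \<times> P). f w)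
      = (\<Sum>w\<in>g ` (P \<times> P). \<Sum>x\<in>{x \<in> P \<times> P. g x = w}. f (g x))"
    by (simp add: sum_distrib_left fibre)
  also have "\<dots> = (\<Sum>x\<in>P \<times> P. f (g x))"
    using P(2) by (intro sum.image_gen[symmetric]) simp
  also have "\<dots> = (\<Sum>p\<in>P. \<Sum>p'\<in>P. f (p \<otimes> s \<otimes> p'))"
    by (simp add: g_def sum.cartesian_product split_def)
  \<comment> \<open>By the symmetry of f the left factor p moves to the right end, where p'
    \<mapsto> p'p only permutes P.\<close>
  also have "\<dots> = (\<Sum>p\<in>P. \<Sum>p'\<in>P. f (s \<otimes> p'))"
  proof (rule sum.cong[OF refl])
    fix p assume p: "p \<in> P"
    have "(\<Sum>p'\<in>P. f (p \<otimes> s \<otimes> p')) = (\<Sum>p'\<in>P. f (s \<otimes> (p' \<otimes> p)))"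
      using p f[of p] by (intro sum.cong) (auto simp: c m_assoc)
    also have "\<dots> = (\<Sum>p'\<in>P. f (s \<otimes> p'))"
      using p by (intro sum.reindex_bij_witness[where j = "\<lambda>x. x \<otimes> p" and i = "\<lambda>x. x \<otimes> inv p"])
        (auto simp: c m_assoc)
    finally show "(\<Sum>p'\<in>P. f (p \<otimes> s \<otimes> p')) = (\<Sum>p'\<in>P. f (s \<otimes> p'))" .
  qed
  finally show ?thesis by (simp add: g_def H_def)
qed

section \<open>Finiteness and size of the spaces of vectors and matrices\<close>

lemma inj_on_vec: "inj_on (vec n) ({..<n} \<rightarrow>\<^sub>E UNIV)"
  by (rule inj_onI) (metis PiE_ext index_vec lessThan_iff)

lemma vec_image: "vec n ` ({..<n} \<rightarrow>\<^sub>E UNIV) = carrier_vec n"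
proof -
  have "v \<in> vec n ` ({..<n} \<rightarrow>\<^sub>E UNIV)" if "v \<in> carrier_vec n" for v :: "'a vec"
    using that by (intro image_eqI[where x = "restrict (\<lambda>i. v $ i) {..<n}"]) auto
  then show ?thesis by auto
qed

lemma card_carrier_vec: "card (carrier_vec n :: 'a::finite vec set) = card (UNIV :: 'a set) ^ n"
  using card_image[OF inj_on_vec[of n, where 'a = 'a]] by (simp add: vec_image card_PiE)

lemma finite_carrier_vec: "finite (carrier_vec n :: 'a::finite vec set)"
  using finite_imageI[OF finite_PiE[of "{..<n}" "\<lambda>_. UNIV :: 'a set"], of "vec n"]
  by (simp add: vec_image)

lemma mat_image: "mat r c ` ({..<r} \<times> {..<c} \<rightarrow>\<^sub>E UNIV) = carrier_mat r c"
proof -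
  have "A \<in> mat r c ` ({..<r} \<times> {..<c} \<rightarrow>\<^sub>E UNIV)" if "A \<in> carrier_mat r c" for A :: "'a mat"
    using that by (intro image_eqI[where x = "restrict (\<lambda>x. A $$ x) ({..<r} \<times> {..<c})"]) auto
  then show ?thesis by auto
qed

lemma inj_on_mat: "inj_on (mat r c) ({..<r} \<times> {..<c} \<rightarrow>\<^sub>E UNIV)"
proof (rule inj_onI)
  fix f g :: "nat \<times> nat \<Rightarrow> 'a"
  assume fg: "f \<in> {..<r} \<times> {..<c} \<rightarrow>\<^sub>E UNIV" "g \<in> {..<r} \<times> {..<c} \<rightarrow>\<^sub>E UNIV" "mat r c f = mat r c g"
  have "f x = g x" if "x \<in> {..<r} \<times> {..<c}" for x
    using that arg_cong[OF fg(3), of "\<lambda>A. A $$ x"] by (cases x) auto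
  then show "f = g" using fg by (intro PiE_ext) auto
qed

lemma card_carrier_mat: "card (carrier_mat r c :: 'a::finite mat set) = card (UNIV :: 'a set) ^ (r * c)"
  using card_image[OF inj_on_mat[of r c, where 'a = 'a]] by (simp add: mat_image card_PiE)

lemma finite_carrier_mat: "finite (carrier_mat r c :: 'a::finite mat set)"
  using finite_imageI[OF finite_PiE[of "{..<r} \<times> {..<c}" "\<lambda>_. UNIV :: 'a set"], of "mat r c"]
  by (simp add: mat_image)

section \<open>Inverses, cancellation and the group of invertible matrices\<close>

lemma GL_I:
  assumes "A \<in> carrier_mat n n" "B \<in> carrier_mat n n" "A * B = 1\<^sub>m n"
  shows "A \<in> GL n"
  using assms mat_mult_left_right_inverse[OF assms]
  by (auto simp: GL_def invertible_mat_def inverts_mat_def)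

lemma GL_carrier: "A \<in> GL n \<Longrightarrow> A \<in> carrier_mat n n"
  by (simp add: GL_def)

lemma mat_inv:
  assumes "A \<in> GL n"
  shows "mat_inv A \<in> carrier_mat n n" "A * mat_inv A = 1\<^sub>m n" "mat_inv A * A = 1\<^sub>m n"
proof -
  have A: "A \<in> carrier_mat n n" using assms by (rule GL_carrier)
  obtain B where B: "A * B = 1\<^sub>m n" "B * A = 1\<^sub>m (dim_row B)"
    using assms A by (auto simp: GL_def invertible_mat_def inverts_mat_def)
  \<comment> \<open>\<open>invertible_mat\<close> does not prescribe the shape of the inverse; both
    dimensions are read off from the two product identities.\<close>
  have "B \<in> carrier_mat n n"
    using A B by (metis carrier_matD carrier_matI index_mult_mat(2,3) index_one_mat(2,3))
  then have "A \<in> Units (ring_mat TYPE('a) n ())"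
    using A B by (auto simp: Units_def ring_mat_def)
  then obtain C where "mat_inverse A = Some C"
    using mat_inverse(1)[OF A, of "()"] by (cases "mat_inverse A") auto
  then show "mat_inv A \<in> carrier_mat n n" "A * mat_inv A = 1\<^sub>m n" "mat_inv A * A = 1\<^sub>m n"
    using mat_inverse(2)[OF A] by (auto simp: mat_inv_def)
qed

lemma mat_inv_unique:
  assumes "A \<in> carrier_mat n n" "B \<in> carrier_mat n n" "A * B = 1\<^sub>m n"
  shows "mat_inv A = B"
proof -
  have G: "A \<in> GL n" by (rule GL_I[OF assms])
  have "mat_inv A = mat_inv A * (A * B)" using assms mat_inv[OF G] by simp
  also have "\<dots> = (mat_inv A * A) * B"
    using assms mat_inv[OF G] by (subst assoc_mult_mat[of _ n n _ n _ n]) auto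
  also have "\<dots> = B" using assms mat_inv[OF G] by simp
  finally show ?thesis .
qed

lemma mat_inv_GL: "A \<in> GL n \<Longrightarrow> mat_inv A \<in> GL n"
  using mat_inv[of A n] GL_I GL_carrier by blast

lemma GL_iff_det: "A \<in> GL n \<longleftrightarrow> A \<in> carrier_mat n n \<and> det A \<noteq> 0"
proof
  assume A: "A \<in> GL n"
  have "det A * det (mat_inv A) = 1"
    using det_mult[OF GL_carrier[OF A] mat_inv(1)[OF A]] mat_inv(2)[OF A] by simp
  then show "A \<in> carrier_mat n n \<and> det A \<noteq> 0" using GL_carrier[OF A] by auto
next
  assume "A \<in> carrier_mat n n \<and> det A \<noteq> 0"
  then have "A \<in> Units (ring_mat TYPE('a) n ())" by (intro det_non_zero_imp_unit) auto
  then show "A \<in> GL n" by (auto simp: Units_def ring_mat_def intro: GL_I)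
qed

lemma finite_GL: "finite (GL n :: 'a::{finite,field} mat set)"
  by (rule finite_subset[OF _ finite_carrier_mat[of n n]]) (auto simp: GL_def)

lemma one_GL: "1\<^sub>m n \<in> GL n"
  by (rule GL_I[of _ _ "1\<^sub>m n"]) auto

lemma mult_GL: "A \<in> GL n \<Longrightarrow> B \<in> GL n \<Longrightarrow> A * B \<in> GL n"
  by (auto simp: GL_iff_det det_mult)

lemma transpose_GL: "A \<in> GL n \<Longrightarrow> transpose_mat A \<in> GL n"
  by (auto simp: GL_iff_det det_transpose)

lemma GL_left_cancel:
  assumes "A \<in> GL n" "B \<in> carrier_mat n m"
  shows "mat_inv A * (A * B) = B" "A * (mat_inv A * B) = B"
proof -
  note A = GL_carrier[OF assms(1)] mat_inv[OF assms(1)]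
  show "mat_inv A * (A * B) = B"
    using A assms(2) by (subst assoc_mult_mat[symmetric, of _ n n _ n _ m]) auto
  show "A * (mat_inv A * B) = B"
    using A assms(2) by (subst assoc_mult_mat[symmetric, of _ n n _ n _ m]) auto
qed

lemma GL_right_cancel:
  assumes "A \<in> GL n" "B \<in> carrier_mat m n"
  shows "B * A * mat_inv A = B" "B * mat_inv A * A = B"
proof -
  note A = GL_carrier[OF assms(1)] mat_inv[OF assms(1)]
  show "B * A * mat_inv A = B"
    using A assms(2) by (subst assoc_mult_mat[of _ m n _ n _ n]) auto
  show "B * mat_inv A * A = B"
    using A assms(2) by (subst assoc_mult_mat[of _ m n _ n _ n]) auto
qed

text \<open>The ambient group for \<open>sum_double_coset\<close>. The trace is a class function on
  all of it, so the orthogonal group itself never has to be set up as a group.\<close>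

definition GL_group :: "nat \<Rightarrow> 'a::field mat monoid" where
  "GL_group n = \<lparr>carrier = GL n, mult = (*), one = 1\<^sub>m n\<rparr>"

lemma group_GL: "group (GL_group n)"
proof (rule groupI)
  show "\<exists>y\<in>carrier (GL_group n). y \<otimes>\<^bsub>GL_group n\<^esub> x = \<one>\<^bsub>GL_group n\<^esub>"
    if "x \<in> carrier (GL_group n)" for x
    using that mat_inv(3)[of x n] mat_inv_GL[of x n] by (auto simp: GL_group_def)
qed (auto simp: GL_group_def mult_GL one_GL dest!: GL_carrier intro: assoc_mult_mat[of _ n n _ n _ n])

lemma inv_GL_group:
  assumes "A \<in> GL n"
  shows "inv\<^bsub>GL_group n\<^esub> A = mat_inv A"
proof -
  interpret group "GL_group n" by (rule group_GL)
  show ?thesis using assms mat_inv[OF assms] mat_inv_GL[OF assms]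
    by (intro inv_equality) (auto simp: GL_group_def)
qed

section \<open>The trace\<close>

lemma mat_trace_comm:
  assumes "A \<in> carrier_mat n m" "B \<in> carrier_mat m n"
  shows "mat_trace (A * B) = mat_trace (B * A :: 'a::comm_semiring_0 mat)"
proof -
  have "mat_trace (A * B) = (\<Sum>i<n. \<Sum>j<m. A $$ (i, j) * B $$ (j, i))"
    using assms by (auto simp: mat_trace_def scalar_prod_def atLeast0LessThan intro!: sum.cong)
  also have "\<dots> = (\<Sum>j<m. \<Sum>i<n. B $$ (j, i) * A $$ (i, j))"
    by (subst sum.swap) (simp add: mult.commute)
  also have "\<dots> = mat_trace (B * A)"
    using assms by (auto simp: mat_trace_def scalar_prod_def atLeast0LessThan intro!: sum.cong)
  finally show ?thesis .
qed

lemma mat_trace_transpose: "A \<in> carrier_mat n n \<Longrightarrow> mat_trace (transpose_mat A) = mat_trace A"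
  by (auto simp: mat_trace_def)

lemma mat_trace_four_block:
  assumes "A \<in> carrier_mat n n" "D \<in> carrier_mat m m"
  shows "mat_trace (four_block_mat A B C D) = mat_trace A + mat_trace D"
proof -
  have "sum f {..<n + m} = sum f {..<n} + (\<Sum>i<m. f (n + i))" for f :: "nat \<Rightarrow> 'a"
    by (induction m) (simp_all add: ac_simps)
  then show ?thesis using assms by (simp add: mat_trace_def)
qed

section \<open>The order of the general linear group\<close>

text \<open>The arguments are row offset, column offset, number of rows and number of columns. It
  undoes \<open>four_block_mat\<close>.\<close>

definition blk :: "'a mat \<Rightarrow> nat \<Rightarrow> nat \<Rightarrow> nat \<Rightarrow> nat \<Rightarrow> 'a mat" where
  "blk A i j r c = mat r c (\<lambda>(k, l). A $$ (i + k, j + l))"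

lemma blk_carrier[simp]: "blk A i j r c \<in> carrier_mat r c"
  by (simp add: blk_def)

lemma blk_dim[simp]: "dim_row (blk A i j r c) = r" "dim_col (blk A i j r c) = c"
  by (simp_all add: blk_def)

lemma blk_index[simp]: "k < r \<Longrightarrow> l < c \<Longrightarrow> blk A i j r c $$ (k, l) = A $$ (i + k, j + l)"
  by (simp add: blk_def)

lemma four_block_blk:
  assumes "A \<in> carrier_mat (a + b) (c + d)"
  shows "four_block_mat (blk A 0 0 a c) (blk A 0 c a d) (blk A a 0 b c) (blk A a c b d) = A"
  using assms by (intro eq_matI) auto

lemma blk_four_block:
  assumes "A \<in> carrier_mat a c" "B \<in> carrier_mat a d" "C \<in> carrier_mat b c" "D \<in> carrier_mat b d"
  shows "blk (four_block_mat A B C D) 0 0 a c = A" "blk (four_block_mat A B C D) 0 c a d = B"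
    "blk (four_block_mat A B C D) a 0 b c = C" "blk (four_block_mat A B C D) a c b d = D"
  using assms by (auto intro!: eq_matI)

lemma four_block_eq_iff:
  assumes "A \<in> carrier_mat a c" "B \<in> carrier_mat a d" "C \<in> carrier_mat b c" "D \<in> carrier_mat b d"
    and "A' \<in> carrier_mat a c" "B' \<in> carrier_mat a d" "C' \<in> carrier_mat b c" "D' \<in> carrier_mat b d"
  shows "four_block_mat A B C D = four_block_mat A' B' C' D' \<longleftrightarrow> A = A' \<and> B = B' \<and> C = C' \<and> D = D'"
  using blk_four_block[OF assms(1-4)] blk_four_block[OF assms(5-8)] by metis

lemma col_mult_mat: "A \<in> carrier_mat n k \<Longrightarrow> B \<in> carrier_mat k m \<Longrightarrow> j < m \<Longrightarrow> col (A * B) j = A *\<^sub>v col B j"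
  by (intro eq_vecI) auto

lemma mult_unit_vec:
  assumes "A \<in> carrier_mat n k" "j < k"
  shows "A *\<^sub>v unit_vec k j = col (A :: 'a::semiring_1 mat) j"
  using col_mult_mat[OF assms(1) one_carrier_mat assms(2)] assms by simp

lemma GL_mult_vec_left_cancel:
  assumes "A \<in> GL n" "v \<in> carrier_vec n"
  shows "mat_inv A *\<^sub>v (A *\<^sub>v v) = v"
  using GL_carrier[OF assms(1)] mat_inv[OF assms(1)] assms(2)
  by (simp add: assoc_mult_mat_vec[symmetric, of _ n n _ n])

lemma GL_col_nonzero:
  assumes "A \<in> GL n" "j < n"
  shows "col A j \<noteq> 0\<^sub>v n"
proof
  assume "col A j = 0\<^sub>v n"
  then have "mat_inv A *\<^sub>v (A *\<^sub>v unit_vec n j) = 0\<^sub>v n"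
    using mat_inv(1)[OF assms(1)] mult_unit_vec[OF GL_carrier[OF assms(1)] assms(2)]
    by (auto intro!: eq_vecI simp: scalar_prod_def)
  then have "unit_vec n j = (0\<^sub>v n :: 'a vec)"
    using GL_mult_vec_left_cancel[OF assms(1), of "unit_vec n j"] by simp
  then have "unit_vec n j $ j = (0\<^sub>v n :: 'a vec) $ j" by simp
  then show False using assms(2) by simp
qed

text \<open>Exchange a nonzero entry i of v with entry 0 to get w. The identity with first column
  replaced by w is lower triangular with diagonal w$0, 1, ..., 1, hence invertible; swapping rows 0
  and i back restores v as first column.\<close>

lemma exists_GL_col:
  fixes v :: "'a::field vec"
  assumes v: "v \<in> carrier_vec n" "v \<noteq> 0\<^sub>v n"
  obtains g where "g \<in> GL n" "col g 0 = v"
proof -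
  obtain i where i: "i < n" "v $ i \<noteq> 0" using v by (auto simp: vec_eq_iff)
  define w where "w = vec n (\<lambda>k. if k = 0 then v $ i else if k = i then v $ 0 else v $ k)"
  define T where "T = mat n n (\<lambda>(r, c). if c = 0 then w $ r else if r = c then 1 else 0)"
  have "det T = prod_list (diag_mat T)"
    by (rule det_lower_triangular[where n = n]) (auto simp: T_def)
  moreover have "0 \<notin> set (diag_mat T)"
    using i by (auto simp: diag_mat_def T_def w_def)
  ultimately have "det T \<noteq> 0" by (simp add: prod_list_zero_iff)
  then have T: "T \<in> GL n" by (simp add: GL_iff_det T_def)
  have "swaprows_mat n 0 i \<in> (GL n :: 'a mat set)"
    using i swaprows_mat_inv[of 0 n i, where 'a = 'a] by (intro GL_I[of _ n "swaprows_mat n 0 i"])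
      (auto simp: swaprows_mat_inv[of 0 n i])
  then have "swaprows 0 i T \<in> GL n"
    using T i GL_carrier[OF T] by (simp add: swaprows_mat[of _ n n] mult_GL)
  moreover have "col (swaprows 0 i T) 0 = v"
    using v i by (intro eq_vecI) (auto simp: T_def w_def)
  ultimately show thesis using that by blast
qed

lemma card_disjoint_fibres:
  assumes "finite V" "\<And>x. x \<in> S \<Longrightarrow> f x \<in> V" "finite S"
  shows "card S = (\<Sum>v\<in>V. card {x \<in> S. f x = v})"
proof -
  have "S = (\<Union>v\<in>V. {x \<in> S. f x = v})" using assms(2) by auto
  then have "card S = card (\<Union>v\<in>V. {x \<in> S. f x = v})" by simp
  also have "\<dots> = (\<Sum>v\<in>V. card {x \<in> S. f x = v})"
    using assms(1,3) by (intro card_UN_disjoint) auto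
  finally show ?thesis .
qed

text \<open>Sort by the first column. Left multiplication is transitive on nonzero vectors, so every
  fibre is as large as the one over the first unit vector, and that fibre consists of the matrices
  with blocks 1, r, 0, A where r is free and A is invertible.\<close>

lemma card_GL_Suc:
  "card (GL (Suc n) :: 'a::{field,finite} mat set)
    = (card (UNIV :: 'a set) ^ Suc n - 1) * (card (UNIV :: 'a set) ^ n * card (GL n :: 'a mat set))"
proof -
  define Y where "Y v = {A \<in> GL (Suc n). col A 0 = v}" for v :: "'a vec"
  define e :: "'a vec" where "e = unit_vec (Suc n) 0"
  have eq: "card (Y v) = card (Y e)" if v: "v \<in> carrier_vec (Suc n)" "v \<noteq> 0\<^sub>v (Suc n)" for v
  proof -
    obtain g where g: "g \<in> GL (Suc n)" "col g 0 = v" by (rule exists_GL_col[OF v])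
    have ge: "g *\<^sub>v e = v" using mult_unit_vec[OF GL_carrier[OF g(1)]] g(2) by (simp add: e_def)
    have "bij_betw (\<lambda>A. g * A) (Y e) (Y v)"
    proof (rule bij_betw_byWitness[where f' = "\<lambda>A. mat_inv g * A"], goal_cases)
      case 1 show ?case using g(1) by (auto simp: Y_def GL_left_cancel dest: GL_carrier)
    next
      case 2 show ?case using g(1) by (auto simp: Y_def GL_left_cancel dest: GL_carrier)
    next
      case 3
      have "g * A \<in> Y v" if "A \<in> Y e" for A
        using that mult_GL[OF g(1), of A] col_mult_mat[OF GL_carrier[OF g(1)], of A "Suc n" 0]
          GL_carrier[of A "Suc n"] ge by (simp add: Y_def)
      then show ?case by auto
    next
      case 4
      have ve: "mat_inv g *\<^sub>v v = e"
        using GL_mult_vec_left_cancel[OF g(1), of e] ge by (simp add: e_def)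
      have "mat_inv g * A \<in> Y e" if "A \<in> Y v" for A
        using that mult_GL[OF mat_inv_GL[OF g(1)], of A] col_mult_mat[OF mat_inv(1)[OF g(1)], of A "Suc n" 0]
          GL_carrier[of A "Suc n"] ve by (simp add: Y_def)
      then show ?case by auto
    qed
    then show ?thesis by (simp add: bij_betw_same_card)
  qed
  define h where "h = (\<lambda>(r, A :: 'a mat). four_block_mat (1\<^sub>m 1) r (0\<^sub>m n 1) A)"
  have "bij_betw h (carrier_mat 1 n \<times> GL n) (Y e)"
    unfolding bij_betw_def
  proof
    show "inj_on h (carrier_mat 1 n \<times> GL n)"
      by (rule inj_onI) (auto simp: h_def four_block_eq_iff[of _ 1 1 _ n _ n] dest!: GL_carrier)
    show "h ` (carrier_mat 1 n \<times> GL n) = Y e"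
    proof (intro equalityI subsetI)
      fix x assume "x \<in> h ` (carrier_mat 1 n \<times> GL n)"
      then obtain r A where x: "r \<in> carrier_mat 1 n" "A \<in> GL n" "x = h (r, A)" by auto
      then have "det x = det A"
        using GL_carrier[of A n] by (simp add: h_def det_four_block_mat_lower_left_zero[of _ 1 _ n])
      then have "x \<in> GL (Suc n)" using x(2) x(1,3) four_block_carrier_mat[of "1\<^sub>m 1" 1 1 A n n r "0\<^sub>m n 1"]
        by (simp add: GL_iff_det h_def)
      moreover have "col x 0 = e" using x(1,3) GL_carrier[OF x(2)]
        by (intro eq_vecI) (auto simp: h_def e_def)
      ultimately show "x \<in> Y e" by (simp add: Y_def)
    next
      fix x assume x: "x \<in> Y e"
      then have xc: "x \<in> carrier_mat (1 + n) (1 + n)" and c: "col x 0 = e"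
        using GL_carrier[of x "Suc n"] by (simp_all add: Y_def)
      have ce: "x $$ (i, 0) = (if i = 0 then 1 else 0)" if "i < Suc n" for i
        using that xc arg_cong[OF c, of "\<lambda>v. v $ i"] by (simp add: e_def unit_vec_def)
      have "x = h (blk x 0 1 1 n, blk x 1 1 n n)"
        using xc ce by (auto simp: h_def intro!: eq_matI)
      moreover have "det (h (blk x 0 1 1 n, blk x 1 1 n n)) = det (blk x 1 1 n n)"
        by (simp add: h_def det_four_block_mat_lower_left_zero[of _ 1 _ n] del: One_nat_def)
      ultimately show "x \<in> h ` (carrier_mat 1 n \<times> GL n)"
        using x by (intro image_eqI[where x = "(blk x 0 1 1 n, blk x 1 1 n n)"]) (auto simp: Y_def GL_iff_det)
    qed
  qed
  then have Ye: "card (Y e) = card (UNIV :: 'a set) ^ n * card (GL n :: 'a mat set)"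
    by (simp add: bij_betw_same_card[symmetric] card_cartesian_product card_carrier_mat)
  have "card (GL (Suc n) :: 'a mat set) = (\<Sum>v\<in>carrier_vec (Suc n) - {0\<^sub>v (Suc n)}. card (Y v))"
    unfolding Y_def
  proof (rule card_disjoint_fibres)
    show "col x 0 \<in> carrier_vec (Suc n) - {0\<^sub>v (Suc n)}" if "x \<in> GL (Suc n)" for x :: "'a mat"
      using GL_col_nonzero[OF that, of 0] GL_carrier[OF that]
        col_carrier_vec[of 0 "Suc n" x "Suc n"] by simp
  qed (auto simp: finite_carrier_vec finite_GL)
  also have "\<dots> = (card (UNIV :: 'a set) ^ Suc n - 1) * card (Y e)"
    using eq by (simp add: card_carrier_vec)
  finally show ?thesis by (simp add: Ye)
qed

lemma card_GL_0: "card (GL 0 :: 'a::field mat set) = 1"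
proof -
  have "GL 0 = {1\<^sub>m 0 :: 'a mat}" by (auto simp: GL_iff_det intro!: eq_matI)
  then show ?thesis by simp
qed

section \<open>Schur complements of symmetric matrices\<close>

definition SymGL :: "nat \<Rightarrow> 'a::field mat set" where
  "SymGL n = {S \<in> GL n. transpose_mat S = S}"

lemma finite_SymGL: "finite (SymGL n :: 'a::{field,finite} mat set)"
  by (auto simp: SymGL_def finite_GL)

text \<open>Block Gauss elimination: a unit lower triangular factor with block U K^-1 turns the
  matrix into an upper triangular one with diagonal blocks K and M. The lower right block is written
  so that M is itself the Schur complement.\<close>

lemma det_Schur_complement:
  fixes K :: "'a::field mat"
  assumes K: "K \<in> GL a" and V: "V \<in> carrier_mat a b" and U: "U \<in> carrier_mat b a" and M: "M \<in> carrier_mat b b"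
  shows "det (four_block_mat K V U (M + U * mat_inv K * V)) = det K * det M"
proof -
  note k = GL_carrier[OF K] mat_inv[OF K]
  have "four_block_mat (1\<^sub>m a) (0\<^sub>m a b) (U * mat_inv K) (1\<^sub>m b) * four_block_mat K V (0\<^sub>m b a) M
    = four_block_mat K V U (M + U * mat_inv K * V)"
    using k V U M GL_right_cancel(2)[OF K U]
    by (subst mult_four_block_mat[of _ a a _ b _ b _ _ a _ b])
      (auto simp: comm_add_mat[of _ b b])
  then have "det (four_block_mat K V U (M + U * mat_inv K * V))
     = det (four_block_mat (1\<^sub>m a) (0\<^sub>m a b) (U * mat_inv K) (1\<^sub>m b)) * det (four_block_mat K V (0\<^sub>m b a) M)"
    using k V U M by (simp add: det_mult[symmetric, of _ "a + b"])
  also have "\<dots> = det K * det M"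
    using k V U M by (simp add: det_four_block_mat_lower_left_zero[of _ a _ b]
      det_four_block_mat_upper_right_zero[of _ a _ b])
  finally show ?thesis .
qed

lemma transpose_mat_inv:
  assumes "A \<in> GL n"
  shows "transpose_mat (mat_inv A) = mat_inv (transpose_mat A)"
proof -
  note A = GL_carrier[OF assms] mat_inv[OF assms]
  have "transpose_mat A * transpose_mat (mat_inv A) = 1\<^sub>m n"
    using A by (simp add: transpose_mult[symmetric, of _ n n _ n])
  then show ?thesis using A by (intro mat_inv_unique[symmetric, of _ n]) auto
qed

text \<open>Once the invertible leading block K and the block U below it are fixed, the matrix is
  determined by its Schur complement, which may be any invertible symmetric matrix of size b. The
  count therefore depends neither on K nor on U.\<close>

lemma card_SymGL_block:
  fixes K :: "'a::{field,finite} mat"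
  assumes K: "K \<in> SymGL a" and U: "U \<in> carrier_mat b a"
  shows "card {S \<in> SymGL (a + b). blk S 0 0 a a = K \<and> blk S a 0 b a = U} = card (SymGL b :: 'a mat set)"
proof -
  define C where "C = U * mat_inv K * transpose_mat U"
  have KG: "K \<in> GL a" "transpose_mat K = K" using K by (auto simp: SymGL_def)
  note k = GL_carrier[OF KG(1)] mat_inv[OF KG(1)]
  have C: "C \<in> carrier_mat b b" using U k by (simp add: C_def)
  \<comment> \<open>Symmetry of the correction term U K^-1 U^t is what lets symmetry pass between
    the lower right block and the Schur complement.\<close>
  have "transpose_mat C = C"
  proof -
    have "transpose_mat C = U * transpose_mat (U * mat_inv K)"
      unfolding C_def using U k by (subst transpose_mult[of _ b a _ b]) auto
    also have "transpose_mat (U * mat_inv K) = mat_inv K * transpose_mat U"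
      using U k KG by (simp add: transpose_mult[of U b a "mat_inv K" a] transpose_mat_inv)
    finally show ?thesis using U k by (simp add: C_def assoc_mult_mat[of _ b a _ a _ b])
  qed
  then have symC: "transpose_mat (M + C) = M + C \<longleftrightarrow> transpose_mat M = M" if "M \<in> carrier_mat b b" for M
    using that C by (auto simp: transpose_add[of _ b b] mat_eq_iff)
  define h where "h M = four_block_mat K (transpose_mat U) U (M + C)" for M
  have hGL: "h M \<in> SymGL (a + b) \<longleftrightarrow> M \<in> SymGL b" if M: "M \<in> carrier_mat b b" for M
  proof -
    have "det (h M) = det K * det M"
      using det_Schur_complement[OF KG(1) _ U M] U by (simp add: h_def C_def)
    then have "h M \<in> GL (a + b) \<longleftrightarrow> M \<in> GL b" using KG(1) k M C by (auto simp: GL_iff_det h_def)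
    moreover have "transpose_mat (h M) = h M \<longleftrightarrow> transpose_mat (M + C) = M + C"
      unfolding h_def using k U M C KG(2)
      by (subst transpose_four_block_mat[of _ a a _ b _ b])
        (auto simp: four_block_eq_iff[of _ a a _ b _ b])
    ultimately show ?thesis using symC[OF M] by (simp add: SymGL_def)
  qed
  have "bij_betw h (SymGL b) {S \<in> SymGL (a + b). blk S 0 0 a a = K \<and> blk S a 0 b a = U}"
    unfolding bij_betw_def
  proof
    have cM: "M \<in> carrier_mat b b" if "M \<in> SymGL b" for M :: "'a mat"
      using that by (auto simp: SymGL_def dest: GL_carrier)
    show "inj_on h (SymGL b)"
    proof (rule inj_onI)
      fix M N assume MN: "M \<in> SymGL b" "N \<in> SymGL b" "h M = h N"
      then have "M + C = N + C" using U k C cM[OF MN(1)] cM[OF MN(2)]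
        by (simp add: h_def four_block_eq_iff[of _ a a _ b _ b])
      then show "M = N" using C cM[OF MN(1)] cM[OF MN(2)] by (auto simp: mat_eq_iff)
    qed
    show "h ` SymGL b = {S \<in> SymGL (a + b). blk S 0 0 a a = K \<and> blk S a 0 b a = U}"
    proof (intro equalityI subsetI)
      fix S assume "S \<in> h ` SymGL b"
      then obtain M where M: "M \<in> SymGL b" "S = h M" by auto
      show "S \<in> {S \<in> SymGL (a + b). blk S 0 0 a a = K \<and> blk S a 0 b a = U}"
        using hGL[OF cM[OF M(1)]] M blk_four_block(1,3)[of K a a "transpose_mat U" b U b "M + C"] k U C cM[OF M(1)]
        by (simp add: h_def)
    next
      fix S assume "S \<in> {S \<in> SymGL (a + b). blk S 0 0 a a = K \<and> blk S a 0 b a = U}"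
      then have S: "S \<in> SymGL (a + b)" "blk S 0 0 a a = K" "blk S a 0 b a = U" by auto
      then have Sc: "S \<in> carrier_mat (a + b) (a + b)" "transpose_mat S = S" by (auto simp: SymGL_def dest: GL_carrier)
      define M where "M = blk S a a b b - C"
      have M: "M \<in> carrier_mat b b" unfolding M_def by (rule minus_carrier_mat[OF C])
      have "blk S 0 a a b = transpose_mat U"
      proof (rule eq_matI)
        fix i j assume "i < dim_row (transpose_mat U)" "j < dim_col (transpose_mat U)"
        then have ij: "i < a" "j < b" using U by auto
        then have "S $$ (i, a + j) = transpose_mat S $$ (i, a + j)" by (simp add: Sc)
        also have "\<dots> = U $$ (j, i)" using ij Sc(1) by (simp add: S(3)[symmetric])
        finally show "blk S 0 a a b $$ (i, j) = transpose_mat U $$ (i, j)" using ij U by simp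
      qed (use U in auto)
      moreover have "blk S a a b b = M + C" using C by (auto simp: M_def intro!: eq_matI)
      ultimately have "S = h M"
        using four_block_blk[OF Sc(1)] S by (simp add: h_def)
      then show "S \<in> h ` SymGL b" using hGL[OF M] S(1) by auto
    qed
  qed
  then show ?thesis by (simp add: bij_betw_same_card)
qed

section \<open>Counting invertible symmetric matrices\<close>

text \<open>The nonzero corner entry serves as a 1 x 1 pivot block, and the rest of w is the block
  U.\<close>

lemma card_SymGL_col_pivot:
  fixes w :: "'a::{field,finite} vec"
  assumes w: "w \<in> carrier_vec (Suc m)" "w $ 0 \<noteq> 0"
  shows "card {S \<in> SymGL (Suc m). col S 0 = w} = card (SymGL m :: 'a mat set)"
proof -
  define K where "K = mat 1 1 (\<lambda>_. w $ 0)"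
  define U where "U = mat m 1 (\<lambda>(i, _). w $ Suc i)"
  have K: "K \<in> SymGL 1"
    using w(2) by (auto simp: SymGL_def GL_iff_det K_def det_single intro!: eq_matI)
  have "col S 0 = w \<longleftrightarrow> blk S 0 0 1 1 = K \<and> blk S 1 0 m 1 = U" if "S \<in> SymGL (Suc m)" for S
  proof -
    have S: "S \<in> carrier_mat (Suc m) (Suc m)" using that by (auto simp: SymGL_def GL_def)
    have "col S 0 = w \<longleftrightarrow> (\<forall>i<Suc m. S $$ (i, 0) = w $ i)"
      using S w(1) by (auto simp: vec_eq_iff)
    also have "\<dots> \<longleftrightarrow> S $$ (0, 0) = w $ 0 \<and> (\<forall>i<m. S $$ (Suc i, 0) = w $ Suc i)"
      by (simp add: All_less_Suc2)
    also have "\<dots> \<longleftrightarrow> blk S 0 0 1 1 = K \<and> blk S 1 0 m 1 = U"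
      by (auto simp: mat_eq_iff K_def U_def)
    finally show ?thesis .
  qed
  then have "{S \<in> SymGL (Suc m). col S 0 = w} = {S \<in> SymGL (1 + m). blk S 0 0 1 1 = K \<and> blk S 1 0 m 1 = U}"
    by auto
  also have "card \<dots> = card (SymGL m :: 'a mat set)"
    by (rule card_SymGL_block[OF K]) (simp add: U_def)
  finally show ?thesis .
qed

text \<open>The corner entry vanishes, so no 1 x 1 pivot is available. The leading 2 x 2 block has
  rows (0, 1) and (1, c) and is invertible for every c, so it can be the pivot. Its entry c and the
  m entries below it in the second column are free, hence the exponent m + 1.\<close>

lemma card_SymGL_col_unit:
  "card {S \<in> SymGL (Suc (Suc m)) :: 'a::{field,finite} mat set. col S 0 = unit_vec (Suc (Suc m)) 1}
    = card (UNIV :: 'a set) ^ Suc m * card (SymGL m :: 'a mat set)"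
proof -
  define X :: "'a mat set" where "X = {S \<in> SymGL (Suc (Suc m)). col S 0 = unit_vec (Suc (Suc m)) 1}"
  define K :: "'a \<Rightarrow> 'a mat" where "K c = mat 2 2 (\<lambda>(i, j). if i = j then if i = 0 then 0 else c else 1)" for c
  define U :: "'a vec \<Rightarrow> 'a mat" where "U u = mat m 2 (\<lambda>(i, j). if j = 0 then 0 else u $ i)" for u
  have K: "K c \<in> SymGL 2" for c
  proof -
    have "K c * mat 2 2 (\<lambda>(i, j). if i = j then if i = 0 then - c else 0 else 1) = 1\<^sub>m 2"
      by (rule eq_matI) (auto simp: K_def scalar_prod_def numeral_2_eq_2 less_Suc_eq)
    then have "K c \<in> GL 2" by (rule GL_I[rotated -1]) (auto simp: K_def)
    then show ?thesis by (auto simp: SymGL_def K_def intro!: eq_matI)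
  qed
  define f where "f S = (S $$ (1, 1), vec m (\<lambda>i. S $$ (i + 2, 1)))" for S :: "'a mat"
  have fib: "card {S \<in> X. f S = cu} = card (SymGL m :: 'a mat set)" if cu0: "cu \<in> UNIV \<times> carrier_vec m" for cu
  proof -
    obtain c u where cu: "cu = (c, u)" "u \<in> carrier_vec m" using cu0 by (cases cu) auto
    have "col S 0 = unit_vec (Suc (Suc m)) 1 \<and> f S = (c, u) \<longleftrightarrow> blk S 0 0 2 2 = K c \<and> blk S 2 0 m 2 = U u"
      if "S \<in> SymGL (2 + m)" for S
    proof -
      have S: "S \<in> carrier_mat (Suc (Suc m)) (Suc (Suc m))" "transpose_mat S = S"
        using that by (auto simp: SymGL_def GL_def)
      have "S $$ (0, 1) = transpose_mat S $$ (0, 1)" by (simp add: S(2))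
      also have "\<dots> = S $$ (1, 0)" using S(1) by simp
      finally have S01: "S $$ (0, Suc 0) = S $$ (Suc 0, 0)" by simp
      have "col S 0 = unit_vec (Suc (Suc m)) 1 \<longleftrightarrow> (\<forall>i<Suc (Suc m). S $$ (i, 0) = (if i = 1 then 1 else 0))"
        using S(1) by (auto simp: vec_eq_iff)
      also have "\<dots> \<longleftrightarrow> S $$ (0, 0) = 0 \<and> S $$ (1, 0) = 1 \<and> (\<forall>i<m. S $$ (Suc (Suc i), 0) = 0)"
        by (simp add: All_less_Suc2)
      finally have 1: "col S 0 = unit_vec (Suc (Suc m)) 1 \<longleftrightarrow>
        S $$ (0, 0) = 0 \<and> S $$ (1, 0) = 1 \<and> (\<forall>i<m. S $$ (Suc (Suc i), 0) = 0)" .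
      have 2: "f S = (c, u) \<longleftrightarrow> S $$ (1, 1) = c \<and> (\<forall>i<m. S $$ (Suc (Suc i), 1) = u $ i)"
        using cu(2) by (auto simp: f_def vec_eq_iff)
      have 3: "blk S 0 0 2 2 = K c \<longleftrightarrow> S $$ (0, 0) = 0 \<and> S $$ (1, 0) = 1 \<and> S $$ (1, 1) = c"
        using S01 by (auto simp: mat_eq_iff K_def numeral_2_eq_2 All_less_Suc2)
      have 4: "blk S 2 0 m 2 = U u \<longleftrightarrow> (\<forall>i<m. S $$ (Suc (Suc i), 0) = 0) \<and> (\<forall>i<m. S $$ (Suc (Suc i), 1) = u $ i)"
        by (auto simp: mat_eq_iff U_def numeral_2_eq_2 All_less_Suc2)
      show ?thesis unfolding 1 2 3 4 by blast
    qed
    then have "{S \<in> X. f S = cu} = {S \<in> SymGL (2 + m). blk S 0 0 2 2 = K c \<and> blk S 2 0 m 2 = U u}"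
      by (auto simp: X_def cu)
    also have "card \<dots> = card (SymGL m :: 'a mat set)"
      by (rule card_SymGL_block[OF K]) (simp add: U_def)
    finally show ?thesis .
  qed
  have "card X = (\<Sum>cu\<in>UNIV \<times> carrier_vec m. card {S \<in> X. f S = cu})"
    by (rule card_disjoint_fibres) (auto simp: f_def finite_carrier_vec X_def finite_SymGL)
  also have "\<dots> = card (UNIV :: 'a set) ^ Suc m * card (SymGL m :: 'a mat set)"
    using fib by (simp add: card_cartesian_product card_carrier_vec)
  finally show ?thesis by (simp add: X_def)
qed

lemma congruence_SymGL:
  assumes H: "H \<in> GL n" and S: "S \<in> SymGL n"
  shows "H * S * transpose_mat H \<in> SymGL n"
proof -
  have S': "S \<in> GL n" "S \<in> carrier_mat n n" "transpose_mat S = S"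
    using S by (auto simp: SymGL_def GL_def)
  note h = GL_carrier[OF H]
  have "transpose_mat (H * S * transpose_mat H) = H * S * transpose_mat H"
    using h S' by (subst transpose_mult[of _ n n _ n], simp, simp, subst transpose_mult[of _ n n _ n])
      (auto simp: assoc_mult_mat[of _ n n _ n _ n])
  then show ?thesis using H S'(1) by (simp add: SymGL_def mult_GL transpose_GL)
qed

text \<open>The congruence S \<mapsto> H S H^t permutes the invertible symmetric matrices. As H^t
  fixes the first unit vector, the first column of the image is H times the first column of
  S.\<close>

lemma card_SymGL_col_congruence:
  fixes H :: "'a::{field,finite} mat"
  assumes H: "H \<in> GL n" and n: "0 < n" and e: "transpose_mat H *\<^sub>v unit_vec n 0 = unit_vec n 0"
    and v: "v \<in> carrier_vec n" and w: "H *\<^sub>v v = w"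
  shows "card {S \<in> SymGL n. col S 0 = w} = card {S \<in> SymGL n. col S 0 = v}"
proof -
  have step: "col (G * S * transpose_mat G) 0 = G *\<^sub>v col S 0"
    if G: "G \<in> GL n" "transpose_mat G *\<^sub>v unit_vec n 0 = unit_vec n 0" and "S \<in> SymGL n" for G S :: "'a mat"
  proof -
    have S: "S \<in> carrier_mat n n" using that by (auto simp: SymGL_def GL_def)
    note g = GL_carrier[OF G(1)]
    have "col (G * S * transpose_mat G) 0 = G * S * transpose_mat G *\<^sub>v unit_vec n 0"
      using g S n by (intro mult_unit_vec[symmetric]) auto
    also have "\<dots> = G *\<^sub>v (S *\<^sub>v (transpose_mat G *\<^sub>v unit_vec n 0))"
      using g S by (simp add: assoc_mult_mat_vec[of _ n n _ n])
    also have "\<dots> = G *\<^sub>v col S 0" using S n by (simp add: G(2) mult_unit_vec)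
    finally show ?thesis .
  qed
  have cancel: "A * (B * S * transpose_mat B) * transpose_mat A = S"
    if "A \<in> carrier_mat n n" "B \<in> carrier_mat n n" "S \<in> carrier_mat n n" "A * B = 1\<^sub>m n" for A B S :: "'a mat"
  proof -
    have "A * (B * S * transpose_mat B) * transpose_mat A = (A * B) * S * (transpose_mat B * transpose_mat A)"
      using that(1-3) by (simp add: assoc_mult_mat[of _ n n _ n _ n])
    also have "transpose_mat B * transpose_mat A = 1\<^sub>m n"
      using that by (simp add: transpose_mult[symmetric, of _ n n _ n])
    finally show ?thesis using that by simp
  qed
  note h = GL_carrier[OF H] mat_inv[OF H]
  have e': "transpose_mat (mat_inv H) *\<^sub>v unit_vec n 0 = unit_vec n 0"
    using GL_mult_vec_left_cancel[OF transpose_GL[OF H], of "unit_vec n 0"] e by (simp add: transpose_mat_inv[OF H])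
  have w': "mat_inv H *\<^sub>v w = v" using GL_mult_vec_left_cancel[OF H v] w by simp
  have c: "S \<in> carrier_mat n n" if "S \<in> SymGL n" for S :: "'a mat"
    using that by (auto simp: SymGL_def GL_def)
  have "bij_betw (\<lambda>S. H * S * transpose_mat H) {S \<in> SymGL n. col S 0 = v} {S \<in> SymGL n. col S 0 = w}"
  proof (rule bij_betw_byWitness[where f' = "\<lambda>S. mat_inv H * S * transpose_mat (mat_inv H)"], goal_cases)
    case 1 show ?case using cancel[OF h(2,1) c h(4)] by simp
  next
    case 2 show ?case using cancel[OF h(1,2) c h(3)] by simp
  next
    case 3 show ?case using congruence_SymGL[OF H] step[OF H e] w by auto
  next
    case 4 show ?case
      using congruence_SymGL[OF mat_inv_GL[OF H]] step[OF mat_inv_GL[OF H] e'] w' by auto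
  qed
  then show ?thesis by (simp add: bij_betw_same_card)
qed

text \<open>w$0 = 0 says that the first basis vector is isotropic for the form S. A congruence by H
  = diag(1, g), where g has the remaining entries of w as first column, reduces w to the second unit
  vector.\<close>

lemma card_SymGL_col_isotropic:
  fixes w :: "'a::{field,finite} vec"
  assumes w: "w \<in> carrier_vec (Suc (Suc m))" "w $ 0 = 0" "w \<noteq> 0\<^sub>v (Suc (Suc m))"
  shows "card {S \<in> SymGL (Suc (Suc m)). col S 0 = w}
    = card (UNIV :: 'a set) ^ Suc m * card (SymGL m :: 'a mat set)"
proof -
  define w' where "w' = vec (Suc m) (\<lambda>i. w $ Suc i)"
  have "w' \<noteq> 0\<^sub>v (Suc m)"
  proof
    assume w'0: "w' = 0\<^sub>v (Suc m)"
    have "w $ Suc i = 0" if "i < Suc m" for i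
    proof -
      have "w $ Suc i = w' $ i" using that by (simp add: w'_def)
      then show ?thesis using that by (simp add: w'0)
    qed
    then have "w $ i = 0" if "i < Suc (Suc m)" for i using that w(2) by (cases i) auto
    then have "w = 0\<^sub>v (Suc (Suc m))" using w(1) by (intro eq_vecI) auto
    then show False using w(3) by simp
  qed
  then obtain g where g: "g \<in> GL (Suc m)" "col g 0 = w'"
    using exists_GL_col[of w' "Suc m"] by (auto simp: w'_def)
  note gc = GL_carrier[OF g(1)]
  define H where "H = four_block_mat (1\<^sub>m 1) (0\<^sub>m 1 (Suc m)) (0\<^sub>m (Suc m) 1) g"
  have Hc: "H \<in> carrier_mat (Suc (Suc m)) (Suc (Suc m))"
    using four_block_carrier_mat[of "1\<^sub>m 1" 1 1 g "Suc m" "Suc m"] gc by (simp add: H_def)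
  have "det H = det g" using gc
    by (simp add: H_def det_four_block_mat_lower_left_zero[of _ 1 _ "Suc m"] del: One_nat_def)
  then have H: "H \<in> GL (Suc (Suc m))" using Hc g(1) by (simp add: GL_iff_det)
  have gw: "g $$ (i, 0) = w $ Suc i" if "i < Suc m" for i
    using that gc arg_cong[OF g(2), of "\<lambda>v. v $ i"] by (simp add: w'_def)
  have "H *\<^sub>v unit_vec (Suc (Suc m)) 1 = col H 1"
    using Hc by (intro mult_unit_vec) auto
  also have "\<dots> = w"
    using w gc gw by (intro eq_vecI) (auto simp: H_def)
  finally have 1: "H *\<^sub>v unit_vec (Suc (Suc m)) 1 = w" .
  have "transpose_mat H *\<^sub>v unit_vec (Suc (Suc m)) 0 = col (transpose_mat H) 0"
    using Hc by (intro mult_unit_vec) auto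
  also have "\<dots> = unit_vec (Suc (Suc m)) 0"
    using gc by (intro eq_vecI) (auto simp: H_def)
  finally have 2: "transpose_mat H *\<^sub>v unit_vec (Suc (Suc m)) 0 = unit_vec (Suc (Suc m)) 0" .
  show ?thesis
    using card_SymGL_col_congruence[OF H _ 2 _ 1] card_SymGL_col_unit[of m, where 'a = 'a] by simp
qed

text \<open>Of the nonzero first columns of length m + 2, those with nonzero top entry number
  q^(m+2) - q^(m+1) and fall under the pivot case; the other q^(m+1) - 1 fall under the isotropic
  case.\<close>

lemma card_SymGL_Suc_Suc:
  defines "q \<equiv> card (UNIV :: 'a::{field,finite} set)"
  shows "card (SymGL (Suc (Suc m)) :: 'a mat set) =
    (q ^ Suc (Suc m) - q ^ Suc m) * card (SymGL (Suc m) :: 'a mat set)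
    + (q ^ Suc m - 1) * (q ^ Suc m * card (SymGL m :: 'a mat set))"
proof -
  let ?n = "Suc (Suc m)"
  define V0 where "V0 = {v \<in> carrier_vec ?n :: 'a vec set. v $ 0 = 0}"
  have "bij_betw (\<lambda>v. vCons 0 v) (carrier_vec (Suc m)) V0"
    by (rule bij_betw_byWitness[where f' = "\<lambda>v. vec (Suc m) (\<lambda>i. v $ Suc i)"])
      (auto simp: V0_def vec_eq_iff vec_index_vCons)
  then have V0: "card V0 = q ^ Suc m"
    by (simp add: bij_betw_same_card[symmetric] card_carrier_vec q_def)
  have fin: "finite (carrier_vec ?n :: 'a vec set)" by (rule finite_carrier_vec)
  have V0s: "V0 \<subseteq> carrier_vec ?n" "finite V0" "0\<^sub>v ?n \<in> V0" using fin by (auto simp: V0_def)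
  have "card (SymGL ?n :: 'a mat set) = (\<Sum>w\<in>carrier_vec ?n - {0\<^sub>v ?n}. card {S \<in> SymGL ?n :: 'a mat set. col S 0 = w})"
  proof (rule card_disjoint_fibres)
    show "col x 0 \<in> carrier_vec ?n - {0\<^sub>v ?n}" if "x \<in> SymGL ?n" for x :: "'a mat"
      using that GL_col_nonzero[of x ?n 0] GL_carrier[of x ?n]
        col_carrier_vec[of 0 ?n x ?n] by (simp add: SymGL_def)
  qed (auto simp: fin finite_SymGL)
  also have "carrier_vec ?n - {0\<^sub>v ?n} = (carrier_vec ?n - V0) \<union> (V0 - {0\<^sub>v ?n})"
    using V0s by auto
  also have "(\<Sum>w\<in>\<dots>. card {S \<in> SymGL ?n :: 'a mat set. col S 0 = w}) =
    (\<Sum>w\<in>carrier_vec ?n - V0. card {S \<in> SymGL ?n :: 'a mat set. col S 0 = w}) +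
    (\<Sum>w\<in>V0 - {0\<^sub>v ?n}. card {S \<in> SymGL ?n :: 'a mat set. col S 0 = w})"
    using fin V0s by (intro sum.union_disjoint) auto
  also have "(\<Sum>w\<in>carrier_vec ?n - V0. card {S \<in> SymGL ?n :: 'a mat set. col S 0 = w})
      = card (carrier_vec ?n - V0) * card (SymGL (Suc m) :: 'a mat set)"
    by (simp add: V0_def card_SymGL_col_pivot)
  also have "card (carrier_vec ?n - V0) = q ^ ?n - q ^ Suc m"
    using V0s V0 by (simp add: card_Diff_subset card_carrier_vec q_def)
  also have "(\<Sum>w\<in>V0 - {0\<^sub>v ?n}. card {S \<in> SymGL ?n :: 'a mat set. col S 0 = w})
      = card (V0 - {0\<^sub>v ?n}) * (q ^ Suc m * card (SymGL m :: 'a mat set))"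
    by (simp add: V0_def card_SymGL_col_isotropic q_def)
  also have "card (V0 - {0\<^sub>v ?n}) = q ^ Suc m - 1"
    using V0s V0 by simp
  finally show ?thesis .
qed

lemma card_SymGL_0: "card (SymGL 0 :: 'a::field mat set) = 1"
proof -
  have "SymGL 0 = {1\<^sub>m 0 :: 'a mat}" by (auto simp: SymGL_def GL_iff_det intro!: eq_matI)
  then show ?thesis by simp
qed

lemma GL_1_image: "GL 1 = (\<lambda>x. mat 1 1 (\<lambda>_. x)) ` (UNIV - {0 :: 'a::field})"
proof -
  have "A \<in> (\<lambda>x. mat 1 1 (\<lambda>_. x)) ` (UNIV - {0})" if "A \<in> GL 1" for A :: "'a mat"
    using that by (intro image_eqI[where x = "A $$ (0, 0)"]) (auto simp: GL_iff_det det_single)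
  moreover have "mat 1 1 (\<lambda>_. x) \<in> GL 1" if "x \<noteq> 0" for x :: 'a
    using that by (simp add: GL_iff_det det_single)
  ultimately show ?thesis by auto
qed

lemma card_SymGL_1: "card (SymGL 1 :: 'a::{field,finite} mat set) = card (UNIV :: 'a set) - 1"
proof -
  have "inj_on (\<lambda>x. mat 1 1 (\<lambda>_. x)) (UNIV - {0 :: 'a})" by (auto simp: inj_on_def mat_eq_iff)
  moreover have "SymGL 1 = (GL 1 :: 'a mat set)"
    unfolding SymGL_def GL_1_image by (auto intro!: eq_matI)
  ultimately have "card (SymGL 1 :: 'a mat set) = card (UNIV - {0 :: 'a})"
    by (simp only: GL_1_image card_image)
  then show ?thesis by (simp add: card_Diff_singleton)
qed

text \<open>Each new size needs the two preceding ones, so the even and the odd formula are proved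
  by one simultaneous induction.\<close>

lemma card_SymGL:
  defines "q \<equiv> card (UNIV :: 'a::{field,finite} set)"
  shows "real (card (SymGL (2 * m) :: 'a mat set)) = real q ^ (m * (m + 1)) * (\<Prod>j = 1..m. real q ^ (2 * j - 1) - 1)"
    and "real (card (SymGL (2 * m + 1) :: 'a mat set)) = real q ^ (m * (m + 1)) * (\<Prod>j = 1..m + 1. real q ^ (2 * j - 1) - 1)"
proof -
  have q: "q \<ge> 1" by (simp add: q_def Suc_le_eq finite_UNIV_card_ge_0)
  have rec: "real (card (SymGL (Suc (Suc k)) :: 'a mat set)) =
      (real q - 1) * real q ^ Suc k * real (card (SymGL (Suc k) :: 'a mat set)) +
      (real q ^ Suc k - 1) * (real q ^ Suc k * real (card (SymGL k :: 'a mat set)))" for k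
  proof -
    have "q ^ Suc k \<le> q ^ Suc (Suc k)" "1 \<le> q ^ Suc k" using q by (auto intro: power_increasing)
    then have "real (q ^ Suc (Suc k) - q ^ Suc k) = (real q - 1) * real q ^ Suc k"
      "real (q ^ Suc k - 1) = real q ^ Suc k - 1"
      by (simp_all add: of_nat_diff algebra_simps)
    then show ?thesis
      unfolding card_SymGL_Suc_Suc q_def[symmetric] of_nat_add of_nat_mult of_nat_power by simp
  qed
  have "real (card (SymGL (2 * m) :: 'a mat set)) = real q ^ (m * (m + 1)) * (\<Prod>j = 1..m. real q ^ (2 * j - 1) - 1)
    \<and> real (card (SymGL (2 * m + 1) :: 'a mat set)) = real q ^ (m * (m + 1)) * (\<Prod>j = 1..m + 1. real q ^ (2 * j - 1) - 1)"
  proof (induction m)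
    case 0
    then show ?case using q by (simp add: card_SymGL_0 card_SymGL_1[unfolded One_nat_def] q_def of_nat_diff)
  next
    case (Suc m)
    let ?Q = "real q" and ?P = "\<Prod>j = 1..m + 1. real q ^ (2 * j - 1) - 1"
    have e: "Suc m * (Suc m + 1) = Suc (Suc (2 * m)) + m * (m + 1)" by simp
    have P: "?P = (\<Prod>j = 1..m. real q ^ (2 * j - 1) - 1) * (?Q ^ (2 * m + 1) - 1)" by simp
    have "real (card (SymGL (2 * Suc m) :: 'a mat set)) =
      (?Q - 1) * ?Q ^ (2 * m + 1) * (?Q ^ (m * (m + 1)) * ?P) +
      (?Q ^ (2 * m + 1) - 1) * (?Q ^ (2 * m + 1) * (?Q ^ (m * (m + 1)) * (\<Prod>j = 1..m. real q ^ (2 * j - 1) - 1)))"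
      using rec[of "2 * m"] Suc by simp
    \<comment> \<open>The last factor of \<open>?P\<close> is the factor Q^(2m+1) - 1 of the second
      term, so both terms share \<open>?P\<close> and the coefficients add up to (Q - 1) + 1 =
      Q.\<close>
    also have "\<dots> = ?Q ^ (2 * m + 1) * ?Q ^ (m * (m + 1)) * ?P * ?Q" unfolding P by (simp add: algebra_simps)
    also have "\<dots> = ?Q ^ (Suc m * (Suc m + 1)) * ?P"
      unfolding e power_add by simp
    finally have 1: "real (card (SymGL (2 * Suc m) :: 'a mat set)) = ?Q ^ (Suc m * (Suc m + 1)) * ?P" .
    have "real (card (SymGL (2 * Suc m + 1) :: 'a mat set)) =
      (?Q - 1) * ?Q ^ Suc (Suc (2 * m)) * (?Q ^ (Suc m * (Suc m + 1)) * ?P) +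
      (?Q ^ Suc (Suc (2 * m)) - 1) * (?Q ^ Suc (Suc (2 * m)) * (?Q ^ (m * (m + 1)) * ?P))"
      using rec[of "Suc (2 * m)"] 1 Suc by simp
    \<comment> \<open>Here the coefficients combine as (Q - 1) Q^(2m+2) + Q^(2m+2) - 1 = Q^(2m+3) -
      1, the next factor of the product.\<close>
    also have "\<dots> = ?Q ^ (Suc m * (Suc m + 1)) * (?P * (?Q ^ (2 * Suc m + 1) - 1))"
      unfolding e power_add[of _ "Suc (Suc (2 * m))" "m * (m + 1)"] by (simp add: algebra_simps)
    also have "?P * (?Q ^ (2 * Suc m + 1) - 1) = (\<Prod>j = 1..Suc m + 1. real q ^ (2 * j - 1) - 1)" by simp
    finally show ?case using 1 by simp
  qed
  then show "real (card (SymGL (2 * m) :: 'a mat set)) = real q ^ (m * (m + 1)) * (\<Prod>j = 1..m. real q ^ (2 * j - 1) - 1)"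
    and "real (card (SymGL (2 * m + 1) :: 'a mat set)) = real q ^ (m * (m + 1)) * (\<Prod>j = 1..m + 1. real q ^ (2 * j - 1) - 1)"
    by auto
qed

section \<open>Kloosterman sums over GL(2)\<close>

text \<open>Orthogonality in the form used below both for the field and for the space of alternating
  matrices: the substitution multiplies the sum by c, which differs from 1.\<close>

lemma sum_eq_0_if_shift:
  fixes \<chi> :: "'b \<Rightarrow> 'c::idom"
  assumes "bij_betw t V V" "\<And>b. b \<in> V \<Longrightarrow> \<chi> (t b) = c * \<chi> b" "c \<noteq> 1"
  shows "(\<Sum>b\<in>V. \<chi> b) = 0"
proof -
  have "(\<Sum>b\<in>V. \<chi> b) = (\<Sum>b\<in>V. \<chi> (t b))" by (rule sum.reindex_bij_betw[OF assms(1), symmetric])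
  also have "\<dots> = c * (\<Sum>b\<in>V. \<chi> b)" by (simp add: assms(2) sum_distrib_left)
  finally have "(1 - c) * (\<Sum>b\<in>V. \<chi> b) = 0" by (simp add: algebra_simps)
  then show ?thesis using assms(3) by simp
qed

lemma additive_character:
  assumes "nontrivial_additive_character \<psi>"
  shows "\<psi> (x + y) = \<psi> x * \<psi> y" "\<psi> 0 = 1"
proof -
  show add: "\<psi> (x + y) = \<psi> x * \<psi> y" for x y
    using assms by (simp add: nontrivial_additive_character_def)
  show "\<psi> 0 = 1"
    using add[of 0 0] assms by (simp add: nontrivial_additive_character_def)
qed

lemma exists_character_ne_1:
  assumes "nontrivial_additive_character \<psi>" "u \<noteq> 0"
  obtains x where "\<psi> (x * u) \<noteq> 1"
proof -
  obtain y where "\<psi> y \<noteq> 1" using assms by (auto simp: nontrivial_additive_character_def)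
  then show thesis using that[of "y / u"] assms(2) by simp
qed

lemma sum_character:
  fixes \<psi> :: "'a::{field,finite} \<Rightarrow> complex"
  assumes "nontrivial_additive_character \<psi>"
  shows "(\<Sum>a\<in>UNIV. \<psi> (a * u)) = (if u = 0 then of_nat (card (UNIV :: 'a set)) else 0)"
proof (cases "u = 0")
  case False
  obtain x where x: "\<psi> (x * u) \<noteq> 1" by (rule exists_character_ne_1[OF assms False])
  have "bij_betw (\<lambda>a. a + x) UNIV UNIV"
    by (rule bij_betw_byWitness[where f' = "\<lambda>a. a - x"]) auto
  then have "(\<Sum>a\<in>UNIV. \<psi> (a * u)) = 0"
    by (rule sum_eq_0_if_shift[where c = "\<psi> (x * u)"])
      (simp_all add: x distrib_right additive_character[OF assms])
  then show ?thesis using False by simp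
qed (simp add: additive_character[OF assms])

text \<open>For b \<noteq> 0 the product bc runs once through the field as c does; b = 0 gives q
  further copies of F 0.\<close>

lemma sum_mult_field:
  fixes F :: "'a::{field,finite} \<Rightarrow> complex"
  defines "q \<equiv> of_nat (card (UNIV :: 'a set))"
  shows "(\<Sum>b\<in>UNIV. \<Sum>c\<in>UNIV. F (b * c)) = q * F 0 + (q - 1) * (\<Sum>e\<in>UNIV. F e)"
proof -
  have "(\<Sum>b\<in>UNIV. \<Sum>c\<in>UNIV. F (b * c)) = (\<Sum>c\<in>UNIV. F (0 * c)) + (\<Sum>b\<in>UNIV - {0}. \<Sum>c\<in>UNIV. F (b * c))"
    by (rule sum.remove) auto
  also have "(\<Sum>b\<in>UNIV - {0}. \<Sum>c\<in>UNIV. F (b * c)) = (\<Sum>b\<in>UNIV - {0 :: 'a}. \<Sum>e\<in>UNIV. F e)"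
  proof (rule sum.cong[OF refl])
    fix b :: 'a assume "b \<in> UNIV - {0}"
    then have "bij_betw (\<lambda>c. b * c) UNIV UNIV"
      by (intro bij_betw_byWitness[where f' = "\<lambda>c. c / b"]) auto
    then show "(\<Sum>c\<in>UNIV. F (b * c)) = (\<Sum>e\<in>UNIV. F e)" by (rule sum.reindex_bij_betw)
  qed
  also have "\<dots> = of_nat (card (UNIV - {0 :: 'a})) * (\<Sum>e\<in>UNIV. F e)" by simp
  also have "of_nat (card (UNIV - {0 :: 'a})) = q - 1"
    using finite_UNIV_card_ge_0[where 'a = 'a] by (simp add: card_Diff_singleton of_nat_diff q_def)
  finally show ?thesis by (simp add: q_def)
qed

lemma kloosterman_GL_1: "kloosterman_GL 1 \<psi> a = kloosterman \<psi> a"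
proof -
  have "mat_inv (mat 1 1 (\<lambda>_. x)) = mat 1 1 (\<lambda>_. inverse x)" if "x \<noteq> 0" for x :: 'a
    using that by (intro mat_inv_unique[of _ 1]) (auto intro!: eq_matI simp: scalar_prod_def)
  moreover have "inj_on (\<lambda>x. mat 1 1 (\<lambda>_. x)) (UNIV - {0 :: 'a})" by (auto simp: inj_on_def mat_eq_iff)
  ultimately show ?thesis
    unfolding kloosterman_GL_def kloosterman_def GL_1_image
    by (subst sum.reindex) (auto simp: mat_trace_def intro!: sum.cong)
qed

definition mat2 :: "'a \<Rightarrow> 'a \<Rightarrow> 'a \<Rightarrow> 'a \<Rightarrow> 'a mat" where
  "mat2 a b c d = mat 2 2 (\<lambda>(i, j). if i = 0 then if j = 0 then a else b else if j = 0 then c else d)"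

lemma mat2_simps[simp]:
  "mat2 a b c d \<in> carrier_mat 2 2" "dim_row (mat2 a b c d) = 2" "dim_col (mat2 a b c d) = 2"
  "mat2 a b c d $$ (0, 0) = a" "mat2 a b c d $$ (0, Suc 0) = b"
  "mat2 a b c d $$ (Suc 0, 0) = c" "mat2 a b c d $$ (Suc 0, Suc 0) = d"
  by (simp_all add: mat2_def)

lemma mat2_mult: "mat2 a b c d * mat2 a' b' c' d' =
    mat2 (a * a' + b * c') (a * b' + b * d') (c * a' + d * c') (c * b' + d * d' :: 'a::semiring_0)"
  by (rule eq_matI) (auto simp: mat2_def scalar_prod_def numeral_2_eq_2 less_Suc_eq)

lemma mat2_cases:
  assumes "A \<in> carrier_mat 2 2"
  obtains a b c d where "A = mat2 a b c d"
proof -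
  have "A = mat2 (A $$ (0, 0)) (A $$ (0, 1)) (A $$ (1, 0)) (A $$ (1, 1))"
    using assms by (intro eq_matI) (auto simp: numeral_2_eq_2 less_Suc_eq)
  then show thesis by (rule that)
qed

lemma mat2_inject: "mat2 a b c d = mat2 a' b' c' d' \<longleftrightarrow> a = a' \<and> b = b' \<and> c = c' \<and> d = d'"
  by (metis mat2_simps(4-7))

lemma det_mat2: "det (mat2 a b c d) = a * d - b * (c :: 'a::field)"
proof -
  have "mat2 a b c d = four_block_mat (mat 1 1 (\<lambda>_. a)) (mat 1 1 (\<lambda>_. b)) (mat 1 1 (\<lambda>_. c)) (mat 1 1 (\<lambda>_. d))"
    by (rule eq_matI) (auto simp: mat2_def numeral_2_eq_2 less_Suc_eq)
  also have "det \<dots> = det (mat 1 1 (\<lambda>_. a) * mat 1 1 (\<lambda>_. d) - mat 1 1 (\<lambda>_. b) * mat 1 1 (\<lambda>_. c))"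
    by (rule det_four_block_mat[of _ 1]) (auto intro!: eq_matI simp: scalar_prod_def)
  also have "\<dots> = a * d - b * c"
    by (subst det_single) (auto simp: scalar_prod_def)
  finally show ?thesis .
qed

lemma mat_trace_mat2: "mat_trace (mat2 a b c d) = a + d"
  by (simp add: mat_trace_def numeral_2_eq_2)

lemma mat_inv_mat2:
  fixes a b c d :: "'a::field"
  assumes "a * d - b * c \<noteq> 0"
  defines "u \<equiv> inverse (a * d - b * c)"
  shows "mat_inv (mat2 a b c d) = mat2 (d * u) (- b * u) (- c * u) (a * u)"
proof (rule mat_inv_unique[of _ 2])
  have u: "(a * d - b * c) * u = 1" using assms(1) by (simp add: u_def)
  have "a * (d * u) + b * (- c * u) = 1" "c * (- b * u) + d * (a * u) = 1"
    using u by (simp_all add: algebra_simps)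
  moreover have "1\<^sub>m 2 = mat2 1 0 0 (1 :: 'a)"
    by (rule eq_matI) (auto simp: mat2_def)
  ultimately show "mat2 a b c d * mat2 (d * u) (- b * u) (- c * u) (a * u) = 1\<^sub>m 2"
    by (simp add: mat2_mult mat2_inject)
qed auto

text \<open>In size 2 the trace of the inverse is the trace divided by the determinant, so a summand
  depends only on a, d and \<delta> = ad - bc. Summing over b and c leaves q times the terms with
  \<delta> = ad, which give K^2, and q - 1 times the terms with arbitrary \<delta>, which give
  q^2.\<close>

lemma kloosterman_GL_2:
  fixes \<psi> :: "'a::{field,finite} \<Rightarrow> complex"
  assumes \<psi>: "nontrivial_additive_character \<psi>"
  defines "q \<equiv> of_nat (card (UNIV :: 'a set))"
  shows "kloosterman_GL 2 \<psi> 1 = q * (kloosterman \<psi> 1 ^ 2 + q ^ 2 - q)"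
proof -
  note add = additive_character[OF \<psi>]
  \<comment> \<open>The value 0 at \<delta> = 0 allows the sum to be extended from invertible
    matrices to all quadruples.\<close>
  define g where "g a d \<delta> = (if \<delta> = 0 then 0 else \<psi> ((a + d) * (1 + inverse \<delta>)))" for a d \<delta>
  \<comment> \<open>The order a, d, b, c puts the off-diagonal entries into the inner sums.\<close>
  define X where "X = {(a, d, b, c). a * d - b * c \<noteq> (0 :: 'a)}"
  have inj: "inj_on (\<lambda>(a, d, b, c). mat2 a b c d) X" by (auto simp: inj_on_def mat2_inject)
  have im: "(\<lambda>(a, d, b, c). mat2 a b c d) ` X = GL 2"
  proof (intro equalityI subsetI)
    fix A :: "'a mat" assume A: "A \<in> GL 2"
    then obtain a b c d where "A = mat2 a b c d" using GL_carrier mat2_cases by blast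
    then show "A \<in> (\<lambda>(a, d, b, c). mat2 a b c d) ` X"
      using A by (intro image_eqI[where x = "(a, d, b, c)"]) (auto simp: X_def GL_iff_det det_mat2)
  qed (auto simp: X_def GL_iff_det det_mat2)
  have "kloosterman_GL 2 \<psi> 1 = (\<Sum>(a, d, b, c)\<in>X. \<psi> (mat_trace (mat2 a b c d) + 1 * mat_trace (mat_inv (mat2 a b c d))))"
    unfolding kloosterman_GL_def im[symmetric] by (subst sum.reindex[OF inj]) (simp add: split_def)
  also have "\<dots> = (\<Sum>(a, d, b, c)\<in>X. g a d (a * d - b * c))"
    by (intro sum.cong) (auto simp: X_def g_def mat_inv_mat2 mat_trace_mat2 algebra_simps)
  also have "\<dots> = (\<Sum>(a, d, b, c)\<in>UNIV. g a d (a * d - b * c))"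
    by (intro sum.mono_neutral_left) (auto simp: X_def g_def)
  also have "\<dots> = (\<Sum>a\<in>UNIV. \<Sum>d\<in>UNIV. \<Sum>b\<in>UNIV. \<Sum>c\<in>UNIV. g a d (a * d - b * c))"
    by (simp add: sum.cartesian_product split_def flip: UNIV_Times_UNIV)
  also have "\<dots> = (\<Sum>a\<in>UNIV. \<Sum>d\<in>UNIV. q * g a d (a * d) + (q - 1) * (\<Sum>\<delta>\<in>UNIV. g a d \<delta>))"
  proof (intro sum.cong refl)
    fix a d :: 'a
    have "(\<Sum>e\<in>UNIV. g a d (a * d - e)) = (\<Sum>\<delta>\<in>UNIV. g a d \<delta>)"
      by (rule sum.reindex_bij_witness[of _ "\<lambda>x. a * d - x" "\<lambda>x. a * d - x"]) auto
    then show "(\<Sum>b\<in>UNIV. \<Sum>c\<in>UNIV. g a d (a * d - b * c)) = q * g a d (a * d) + (q - 1) * (\<Sum>\<delta>\<in>UNIV. g a d \<delta>)"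
      using sum_mult_field[of "\<lambda>e. g a d (a * d - e)"] by (simp add: q_def)
  qed
  also have "\<dots> = q * (\<Sum>a\<in>UNIV. \<Sum>d\<in>UNIV. g a d (a * d)) + (q - 1) * (\<Sum>a\<in>UNIV. \<Sum>d\<in>UNIV. \<Sum>\<delta>\<in>UNIV. g a d \<delta>)"
    by (simp add: sum.distrib sum_distrib_left)
  also have "(\<Sum>a\<in>UNIV. \<Sum>d\<in>UNIV. g a d (a * d)) = kloosterman \<psi> 1 ^ 2"
  proof -
    have "(\<Sum>a\<in>UNIV. \<Sum>d\<in>UNIV. g a d (a * d)) = (\<Sum>a\<in>UNIV - {0}. \<Sum>d\<in>UNIV. g a d (a * d))"
      by (intro sum.mono_neutral_right) (auto simp: g_def)
    also have "\<dots> = (\<Sum>a\<in>UNIV - {0}. \<Sum>d\<in>UNIV - {0}. g a d (a * d))"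
      by (intro sum.cong refl sum.mono_neutral_right) (auto simp: g_def)
    \<comment> \<open>With \<delta> = ad the argument separates: (a + d)(1 + 1/(ad)) = (a + 1/a) +
      (d + 1/d).\<close>
    also have "\<dots> = (\<Sum>a\<in>UNIV - {0}. \<Sum>d\<in>UNIV - {0}. \<psi> (a + 1 * inverse a) * \<psi> (d + 1 * inverse d))"
      by (intro sum.cong refl) (auto simp: g_def add(1)[symmetric] field_simps)
    finally show ?thesis by (simp add: kloosterman_def power2_eq_square sum_product)
  qed
  also have "(\<Sum>a\<in>UNIV. \<Sum>d\<in>UNIV. \<Sum>\<delta>\<in>UNIV. g a d \<delta>) = q ^ 2"
  proof -
    have "(\<Sum>a\<in>UNIV. \<Sum>d\<in>UNIV. \<Sum>\<delta>\<in>UNIV. g a d \<delta>) = (\<Sum>a\<in>UNIV. \<Sum>\<delta>\<in>UNIV. \<Sum>d\<in>UNIV. g a d \<delta>)"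
      by (rule sum.cong[OF refl]) (rule sum.swap)
    also have "\<dots> = (\<Sum>\<delta>\<in>UNIV. \<Sum>a\<in>UNIV. \<Sum>d\<in>UNIV. g a d \<delta>)" by (rule sum.swap)
    also have "\<dots> = (\<Sum>\<delta>\<in>UNIV. if \<delta> = (- 1 :: 'a) then q ^ 2 else 0)"
    proof (rule sum.cong[OF refl])
      fix \<delta> :: 'a
      show "(\<Sum>a\<in>UNIV. \<Sum>d\<in>UNIV. g a d \<delta>) = (if \<delta> = - 1 then q ^ 2 else 0)"
      proof (cases "\<delta> = 0")
        case False
        \<comment> \<open>For fixed nonzero \<delta> the double sum is the square of a complete
          character sum with coefficient 1 + 1/\<delta>; only \<delta> = -1 survives.\<close>
        have "1 + inverse \<delta> = 0 \<longleftrightarrow> \<delta> = - 1" using False by (simp add: field_simps add_eq_0_iff2) (metis minus_minus)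
        moreover have "(\<Sum>a\<in>UNIV. \<Sum>d\<in>UNIV. g a d \<delta>) = (\<Sum>a\<in>UNIV. \<psi> (a * (1 + inverse \<delta>))) ^ 2"
          unfolding power2_eq_square sum_product using False
          by (intro sum.cong refl) (simp add: g_def add(1)[symmetric] distrib_right)
        ultimately show ?thesis by (simp add: sum_character[OF \<psi>] q_def)
      qed (simp add: g_def)
    qed
    finally show ?thesis by simp
  qed
  finally show ?thesis by (simp add: algebra_simps power2_eq_square)
qed

section \<open>Gaussian binomials as indices of block triangular subgroups\<close>

lemma card_GL_1: "card (GL 1 :: 'a::{field,finite} mat set) = card (UNIV :: 'a set) - 1"
  using card_GL_Suc[of 0, where 'a = 'a] by (simp add: card_GL_0)

lemma card_field_gt_1: "1 < card (UNIV :: 'a::{field,finite} set)"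
proof -
  have "card {0, 1 :: 'a} \<le> card (UNIV :: 'a set)" by (rule card_mono) auto
  then show ?thesis by simp
qed

text \<open>The factors next to the Gaussian binomial form the order of the block triangular
  subgroup with diagonal blocks of sizes s and 1. The exponent is left as \<open>s * 1\<close> to
  match the hypothesis \<open>g\<close> of \<open>sum_P_double_coset\<close>.\<close>

lemma card_GL_gauss_binomial_1:
  defines "q \<equiv> card (UNIV :: 'a::{field,finite} set)"
  shows "real (card (GL (s + 1) :: 'a mat set))
    = gauss_binomial q (s + 1) 1 * real q ^ (s * 1) * real (card (GL s :: 'a mat set)) * real (card (GL 1 :: 'a mat set))"
proof -
  have q: "q > 1" unfolding q_def by (rule card_field_gt_1)
  then have "1 \<le> q ^ Suc s" by simp
  then show ?thesis using q
    by (simp add: card_GL_Suc[of s] card_GL_1[unfolded One_nat_def] gauss_binomial_def q_def[symmetric] of_nat_diff field_simps)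
qed

lemma card_GL_gauss_binomial_2:
  defines "q \<equiv> card (UNIV :: 'a::{field,finite} set)"
  shows "real (card (GL (s + 2) :: 'a mat set))
    = gauss_binomial q (s + 2) 2 * real q ^ (s * 2) * real (card (GL s :: 'a mat set)) * real (card (GL 2 :: 'a mat set))"
proof -
  have q: "q > 1" unfolding q_def by (rule card_field_gt_1)
  then have *: "real (q ^ Suc k - 1) = real q ^ Suc k - 1" for k by (subst of_nat_diff) auto
  have "real q ^ 2 \<noteq> 1" using q by (simp add: power2_eq_1_iff)
  then have ne: "real q ^ 2 - 1 \<noteq> 0" "real q - 1 \<noteq> 0" using q by auto
  have G: "real (card (GL (s + 2) :: 'a mat set)) =
      (real q ^ (s + 2) - 1) * real q ^ (s + 1) * ((real q ^ (s + 1) - 1) * real q ^ s * real (card (GL s :: 'a mat set)))"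
    using card_GL_Suc[of "Suc s", where 'a = 'a] card_GL_Suc[of s, where 'a = 'a] *[of s] *[of "Suc s"]
    by (simp add: q_def[symmetric])
  have G2: "real (card (GL 2 :: 'a mat set)) = (real q ^ 2 - 1) * real q * (real q - 1)"
    using card_GL_Suc[of "Suc 0", where 'a = 'a] card_GL_1[where 'a = 'a] *[of 0] *[of 1]
    by (simp add: q_def[symmetric] numeral_2_eq_2)
  have B: "gauss_binomial q (s + 2) 2 = (real q ^ (s + 2) - 1) / (real q ^ 2 - 1) * ((real q ^ (s + 1) - 1) / (real q - 1))"
    by (simp add: gauss_binomial_def numeral_2_eq_2)
  have e: "real q ^ (s * 2) * real q = real q ^ (s + 1) * real q ^ s"
    by (simp add: power_add[symmetric] power_Suc2[symmetric] mult_2_right del: power_Suc)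
  \<comment> \<open>The remaining identity is stated for arbitrary reals so that the powers of q
    stay opaque; their only relation needed is \<open>e\<close>.\<close>
  have "X * Q * (Y * R * g) = X / a * (Y / b) * S * g * (a * T * b)"
    if "S * T = Q * R" "a \<noteq> 0" "b \<noteq> 0" for X Y Q R S T a b g :: real
    using that by (simp add: ac_simps)
  then show ?thesis unfolding G G2 B using e ne by blast
qed

section \<open>Alternating matrices and the parabolic subgroup\<close>

text \<open>The range of B in \<open>P_plus\<close>. In characteristic 2 these are the matrices of
  alternating bilinear forms.\<close>

definition Alt :: "nat \<Rightarrow> 'a::field mat set" where
  "Alt n = {B \<in> carrier_mat n n. transpose_mat B = B \<and> (\<forall>i<n. B $$ (i, i) = 0)}"

lemma Alt_I:
  assumes "B \<in> carrier_mat n n" "\<And>i j. i < n \<Longrightarrow> j < n \<Longrightarrow> B $$ (i, j) = B $$ (j, i)" "\<And>i. i < n \<Longrightarrow> B $$ (i, i) = 0"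
  shows "B \<in> Alt n"
  using assms by (auto simp: Alt_def intro!: eq_matI)

lemma Alt_D:
  assumes "B \<in> Alt n"
  shows "B \<in> carrier_mat n n" "transpose_mat B = B" "i < n \<Longrightarrow> j < n \<Longrightarrow> B $$ (i, j) = B $$ (j, i)" "i < n \<Longrightarrow> B $$ (i, i) = 0"
proof -
  show B: "B \<in> carrier_mat n n" "transpose_mat B = B" "i < n \<Longrightarrow> B $$ (i, i) = 0" using assms by (auto simp: Alt_def)
  show "B $$ (i, j) = B $$ (j, i)" if "i < n" "j < n"
    using that B(1) arg_cong[OF B(2), of "\<lambda>M. M $$ (i, j)"] by simp
qed

lemma zero_Alt: "0\<^sub>m n n \<in> Alt n"
  by (rule Alt_I) auto

lemma add_Alt: "B \<in> Alt n \<Longrightarrow> C \<in> Alt n \<Longrightarrow> B + C \<in> Alt n"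
  using Alt_D[of B n] Alt_D[of C n] by (intro Alt_I) auto

lemma finite_Alt: "finite (Alt n :: 'a::{field,finite} mat set)"
  by (rule finite_subset[OF _ finite_carrier_mat[of n n]]) (auto simp: Alt_def)

lemma four_block_Alt_iff:
  assumes "A \<in> carrier_mat n n" "B \<in> carrier_mat n m" "C \<in> carrier_mat m n" "D \<in> carrier_mat m m"
  shows "four_block_mat A B C D \<in> Alt (n + m) \<longleftrightarrow> A \<in> Alt n \<and> D \<in> Alt m \<and> C = transpose_mat B"
proof -
  have 1: "transpose_mat (four_block_mat A B C D) = four_block_mat A B C D \<longleftrightarrow>
    transpose_mat A = A \<and> transpose_mat C = B \<and> transpose_mat B = C \<and> transpose_mat D = D"
    using assms by (simp add: transpose_four_block_mat[OF assms] four_block_eq_iff[of _ n n _ m _ m])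
  have 2: "(\<forall>i<n + m. four_block_mat A B C D $$ (i, i) = 0) \<longleftrightarrow> (\<forall>i<n. A $$ (i, i) = 0) \<and> (\<forall>i<m. D $$ (i, i) = 0)"
    (is "?L \<longleftrightarrow> ?R")
  proof
    assume L: ?L
    show ?R
    proof (intro conjI allI impI)
      fix i assume "i < n" then show "A $$ (i, i) = 0" using spec[OF L, of i] assms by simp
    next
      fix i assume "i < m" then show "D $$ (i, i) = 0" using spec[OF L, of "n + i"] assms by simp
    qed
  qed (use assms in auto)
  show ?thesis unfolding Alt_def using 1 2 assms four_block_carrier_mat[OF assms(1,4), of B C]
    by auto
qed

lemma add_self_eq_0: "(1 :: 'a::field) + 1 = 0 \<Longrightarrow> x + x = (0 :: 'a)"
  by (metis distrib_left mult.right_neutral mult_zero_right)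

text \<open>The diagonal of C + C^t is twice that of C, hence zero; conversely the strictly upper
  triangular part of B serves as C. This description replaces the diagonal condition in what
  follows.\<close>

lemma Alt_eq_symmetrisation:
  assumes c2: "(1 :: 'a::field) + 1 = 0"
  shows "Alt n = {C + transpose_mat C | C. C \<in> (carrier_mat n n :: 'a mat set)}"
proof (intro equalityI subsetI)
  note c2' = add_self_eq_0[OF c2]
  fix B :: "'a mat" assume "B \<in> {C + transpose_mat C | C. C \<in> carrier_mat n n}"
  then show "B \<in> Alt n" by (auto intro!: Alt_I simp: c2' add.commute)
next
  fix B :: "'a mat" assume B: "B \<in> Alt n"
  define C where "C = mat n n (\<lambda>(i, j). if i < j then B $$ (i, j) else 0)"
  have "B = C + transpose_mat C"
  proof (rule eq_matI)
    fix i j assume "i < dim_row (C + transpose_mat C)" "j < dim_col (C + transpose_mat C)"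
    then show "B $$ (i, j) = (C + transpose_mat C) $$ (i, j)"
      using Alt_D(3,4)[OF B] by (cases i j rule: linorder_cases) (auto simp: C_def)
  qed (use Alt_D(1)[OF B] in \<open>auto simp: C_def\<close>)
  moreover have "C \<in> carrier_mat n n" by (simp add: C_def)
  ultimately show "B \<in> {C + transpose_mat C | C. C \<in> carrier_mat n n}" by blast
qed

text \<open>If B = C + C^t then X^t B X = F + F^t with F = X^t C X, which avoids computing diagonal
  entries.\<close>

lemma congruence_Alt:
  assumes c2: "(1 :: 'a::field) + 1 = 0" and B: "B \<in> Alt m" and X: "(X :: 'a mat) \<in> carrier_mat m n"
  shows "transpose_mat X * B * X \<in> Alt n"
proof -
  obtain C where C: "C \<in> carrier_mat m m" "B = C + transpose_mat C"
    using B unfolding Alt_eq_symmetrisation[OF c2] by blast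
  define F where "F = transpose_mat X * C * X"
  have F: "F \<in> carrier_mat n n" using X C by (simp add: F_def)
  have "transpose_mat F = transpose_mat X * transpose_mat (transpose_mat X * C)"
    unfolding F_def using X C by (subst transpose_mult[of _ n m _ n]) auto
  also have "transpose_mat (transpose_mat X * C) = transpose_mat C * X"
    using X C by (subst transpose_mult[of _ n m _ m]) auto
  finally have FT: "transpose_mat F = transpose_mat X * transpose_mat C * X"
    using X C by (simp add: assoc_mult_mat[of _ n m _ m _ n])
  have "transpose_mat X * (C + transpose_mat C) * X = (transpose_mat X * C + transpose_mat X * transpose_mat C) * X"
    using X C(1) by (simp only: mult_add_distrib_mat[of "transpose_mat X" n m C m "transpose_mat C"]
      transpose_carrier_mat)
  also have "\<dots> = F + transpose_mat F"
    unfolding FT unfolding F_def using X C(1) by (intro add_mult_distrib_mat[of _ n m _ _ n]) auto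
  finally have "transpose_mat X * B * X = F + transpose_mat F" by (simp only: C(2))
  then show ?thesis unfolding Alt_eq_symmetrisation[OF c2] using F by blast
qed

text \<open>These are the B-coordinates of the elements of P that conjugation by \<sigma> keeps in
  P.\<close>

definition AltZ :: "nat \<Rightarrow> nat \<Rightarrow> 'a::field mat set" where
  "AltZ n s = {B \<in> Alt n. \<forall>i<s. \<forall>j<s. B $$ (i, j) = 0}"

lemma AltZ_0: "AltZ n 0 = Alt n"
  by (simp add: AltZ_def)

text \<open>The free entries are those above the diagonal in the columns s, ..., n - 1, and column j
  has j of them. The index set \<open>T\<close> lists them as pairs of column and row.\<close>

lemma card_AltZ:
  assumes "s \<le> n"
  shows "card (AltZ n s :: 'a::{field,finite} mat set) = card (UNIV :: 'a set) ^ (\<Sum>j=s..<n. j)"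
proof -
  define T where "T = (SIGMA j:{s..<n}. {..<j})"
  define h where "h f = mat n n (\<lambda>(i, j). if i < j \<and> s \<le> j then f (j, i) else if j < i \<and> s \<le> i then f (i, j) else (0 :: 'a))" for f
  have "bij_betw h (T \<rightarrow>\<^sub>E UNIV) (AltZ n s)"
  proof (rule bij_betw_byWitness[where f' = "\<lambda>B. restrict (\<lambda>(j, i). B $$ (i, j)) T"])
    show "\<forall>f\<in>T \<rightarrow>\<^sub>E UNIV. restrict (\<lambda>(j, i). h f $$ (i, j)) T = f"
      by (auto simp: T_def h_def fun_eq_iff restrict_def PiE_def extensional_def)
    show "\<forall>B\<in>AltZ n s. h (restrict (\<lambda>(j, i). B $$ (i, j)) T) = B"
    proof
      fix B :: "'a mat" assume "B \<in> AltZ n s"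
      then have B: "B \<in> Alt n" "\<And>i j. i < s \<Longrightarrow> j < s \<Longrightarrow> B $$ (i, j) = 0" by (auto simp: AltZ_def)
      show "h (restrict (\<lambda>(j, i). B $$ (i, j)) T) = B"
      proof (rule eq_matI)
        fix i j assume "i < dim_row B" "j < dim_col B"
        then have ij: "i < n" "j < n" using Alt_D(1)[OF B(1)] by auto
        then show "h (restrict (\<lambda>(j, i). B $$ (i, j)) T) $$ (i, j) = B $$ (i, j)"
          using Alt_D(3)[OF B(1), of i j] Alt_D(4)[OF B(1), of i] B(2)[of i j]
          by (cases i j rule: linorder_cases) (auto simp: h_def T_def)
      qed (use Alt_D(1)[OF B(1)] in \<open>auto simp: h_def\<close>)
    qed
    show "h ` (T \<rightarrow>\<^sub>E UNIV) \<subseteq> AltZ n s"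
      using assms by (auto simp: AltZ_def h_def intro!: Alt_I)
  qed auto
  then have "card (AltZ n s :: 'a mat set) = card (T \<rightarrow>\<^sub>E (UNIV :: 'a set))" by (simp add: bij_betw_same_card)
  also have "\<dots> = card (UNIV :: 'a set) ^ card T"
    by (subst card_PiE) (auto simp: T_def)
  also have "card T = (\<Sum>j=s..<n. j)" by (simp add: T_def)
  finally show ?thesis .
qed

lemma card_Alt: "card (Alt n :: 'a::{field,finite} mat set) = card (UNIV :: 'a set) ^ (\<Sum>j<n. j)"
  using card_AltZ[of 0 n, where 'a = 'a] by (simp add: AltZ_0 atLeast0LessThan)

text \<open>The power of q here is all that the B-coordinates contribute to the index of P \<inter>
  \<sigma>P\<sigma> in P.\<close>

lemma card_Alt_AltZ:
  assumes "s \<le> n"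
  shows "card (Alt n :: 'a::{field,finite} mat set) = card (UNIV :: 'a set) ^ (\<Sum>j<s. j) * card (AltZ n s :: 'a mat set)"
proof -
  have "(\<Sum>j<n. j) = (\<Sum>j<s. j) + (\<Sum>j=s..<n. j)"
    using sum.atLeastLessThan_concat[of 0 s n "\<lambda>j. j"] assms by (simp add: atLeast0LessThan)
  then show ?thesis by (simp add: card_Alt card_AltZ[OF assms] power_add)
qed

section \<open>The quadratic form and the orthogonal group in characteristic 2\<close>

definition polar :: "nat \<Rightarrow> 'a::field mat" where
  "polar n = four_block_mat (0\<^sub>m n n) (1\<^sub>m n) (0\<^sub>m n n) (0\<^sub>m n n)"

lemma polar_carrier[simp]: "polar n \<in> carrier_mat (n + n) (n + n)"
  by (simp add: polar_def)

text \<open>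
  Let $G$ be the matrix \<open>polar n\<close>. Then $x^t G x = \theta^+(x)$, so $w$ preserves $\theta^+$ iff
  $w^t G w - G$ is alternating; in characteristic 2 the difference is the sum.
\<close>

definition Oplus :: "nat \<Rightarrow> 'a::field mat set" where
  "Oplus n = {w \<in> carrier_mat (n + n) (n + n). transpose_mat w * polar n * w + polar n \<in> Alt (n + n)}"

lemma four_block_Oplus_iff:
  assumes c2: "(1 :: 'a::field) + 1 = 0"
    and "A \<in> carrier_mat n n" "X \<in> carrier_mat n n" "C \<in> carrier_mat n n" "(Y :: 'a mat) \<in> carrier_mat n n"
  shows "four_block_mat A X C Y \<in> Oplus n \<longleftrightarrow>
    transpose_mat A * C \<in> Alt n \<and> transpose_mat X * Y \<in> Alt n \<and> transpose_mat X * C = transpose_mat (transpose_mat A * Y + 1\<^sub>m n)"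
proof -
  let ?w = "four_block_mat A X C Y"
  have "transpose_mat ?w * polar n = four_block_mat (0\<^sub>m n n) (transpose_mat A) (0\<^sub>m n n) (transpose_mat X)"
    unfolding polar_def transpose_four_block_mat[OF assms(2-5)] using assms(2-5)
    by (subst mult_four_block_mat[of _ n n _ n _ n _ _ n _ n]) auto
  then have "transpose_mat ?w * polar n * ?w =
      four_block_mat (transpose_mat A * C) (transpose_mat A * Y) (transpose_mat X * C) (transpose_mat X * Y)"
    using assms(2-5) by (simp add: mult_four_block_mat[of _ n n _ n _ n _ _ n _ n])
  then have "transpose_mat ?w * polar n * ?w + polar n =
      four_block_mat (transpose_mat A * C) (transpose_mat A * Y + 1\<^sub>m n) (transpose_mat X * C) (transpose_mat X * Y)"
    unfolding polar_def using assms(2-5) by (simp add: add_four_block_mat[of _ n n _ n _ n])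
  then show ?thesis
    using assms(2-5) by (simp add: Oplus_def four_block_Alt_iff[of _ n _ n])
qed

text \<open>With G = \<open>polar n\<close> the defect of wv splits as v^t (w^t G w + G) v + (v^t G
  v + G). The first summand is a congruence of an alternating matrix, the second is the defect of
  v.\<close>

lemma mult_Oplus:
  assumes c2: "(1 :: 'a::field) + 1 = 0" and w: "w \<in> Oplus n" and v: "(v :: 'a mat) \<in> Oplus n"
  shows "w * v \<in> Oplus n"
proof -
  let ?N = "n + n"
  note c2' = add_self_eq_0[OF c2]
  have wc: "w \<in> carrier_mat ?N ?N" "v \<in> carrier_mat ?N ?N" using w v by (auto simp: Oplus_def)
  note pc = polar_carrier[of n, where 'a = 'a]
  let ?W = "transpose_mat w * polar n * w"
  have "transpose_mat (w * v) * polar n * (w * v) = transpose_mat v * transpose_mat w * polar n * (w * v)"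
    using wc by (simp only: transpose_mult[of w ?N ?N v ?N])
  also have "transpose_mat v * transpose_mat w * polar n = transpose_mat v * (transpose_mat w * polar n)"
    using wc by (intro assoc_mult_mat[of _ ?N ?N _ ?N _ ?N]) auto
  also have "\<dots> * (w * v) = transpose_mat v * (transpose_mat w * polar n * (w * v))"
    using wc by (intro assoc_mult_mat[of _ ?N ?N _ ?N _ ?N]) auto
  also have "transpose_mat w * polar n * (w * v) = ?W * v"
    using wc by (intro assoc_mult_mat[of _ ?N ?N _ ?N _ ?N, symmetric]) auto
  also have "transpose_mat v * (?W * v) = transpose_mat v * ?W * v"
    using wc by (intro assoc_mult_mat[of _ ?N ?N _ ?N _ ?N, symmetric]) auto
  finally have "transpose_mat (w * v) * polar n * (w * v) = transpose_mat v * ?W * v" .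
  moreover have "transpose_mat v * (?W + polar n) * v = transpose_mat v * ?W * v + transpose_mat v * polar n * v"
  proof -
    have "transpose_mat v * (?W + polar n) = transpose_mat v * ?W + transpose_mat v * polar n"
      using wc by (intro mult_add_distrib_mat[of _ ?N ?N _ ?N]) auto
    also have "\<dots> * v = transpose_mat v * ?W * v + transpose_mat v * polar n * v"
      using wc by (intro add_mult_distrib_mat[of _ ?N ?N _ _ ?N]) auto
    finally show ?thesis .
  qed
  \<comment> \<open>The term v^t G v occurs twice and cancels in characteristic 2.\<close>
  moreover have "P + Q + (Q + R) = P + R" if "P \<in> carrier_mat ?N ?N" "Q \<in> carrier_mat ?N ?N" "R \<in> carrier_mat ?N ?N" for P Q R :: "'a mat"
    using that c2 by (intro eq_matI) (auto simp: algebra_simps)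
  moreover have "transpose_mat v * ?W * v \<in> carrier_mat ?N ?N" "transpose_mat v * polar n * v \<in> carrier_mat ?N ?N"
    using wc by auto
  ultimately have "transpose_mat (w * v) * polar n * (w * v) + polar n =
      transpose_mat v * (?W + polar n) * v + (transpose_mat v * polar n * v + polar n)"
    using pc by metis
  also have "\<dots> \<in> Alt ?N"
    by (rule add_Alt[OF congruence_Alt[OF c2]]) (use w v in \<open>auto simp: Oplus_def\<close>)
  finally show ?thesis using wc by (simp add: Oplus_def)
qed

definition parabolic :: "nat \<Rightarrow> 'a::field mat \<Rightarrow> 'a mat \<Rightarrow> 'a mat" where
  "parabolic n A B = four_block_mat A (A * B) (0\<^sub>m n n) (transpose_mat (mat_inv A))"

lemma P_plus_eq: "P_plus n = (\<lambda>(A, B). parabolic n A B) ` (GL n \<times> Alt n)"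
proof -
  have *: "four_block_mat A (0\<^sub>m n n) (0\<^sub>m n n) (transpose_mat (mat_inv A)) *
      four_block_mat (1\<^sub>m n) B (0\<^sub>m n n) (1\<^sub>m n) = parabolic n A B"
    if "A \<in> GL n" "B \<in> Alt n" for A B :: "'a mat"
    using GL_carrier[OF that(1)] mat_inv[OF that(1)] Alt_D(1)[OF that(2)]
    by (simp add: parabolic_def mult_four_block_mat[of _ n n _ n _ n _ _ n _ n])
  have "P_plus n = {four_block_mat A (0\<^sub>m n n) (0\<^sub>m n n) (transpose_mat (mat_inv A)) *
      four_block_mat (1\<^sub>m n) B (0\<^sub>m n n) (1\<^sub>m n) | A B. A \<in> GL n \<and> B \<in> (Alt n :: 'a mat set)}"
    unfolding P_plus_def by (simp add: Alt_def)
  also have "\<dots> = {parabolic n A B | A B. A \<in> GL n \<and> B \<in> Alt n}"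
    using * by (intro Collect_cong ex_cong1) auto
  finally show ?thesis by auto
qed

lemma parabolic_carrier: "A \<in> GL n \<Longrightarrow> parabolic n A B \<in> carrier_mat (n + n) (n + n)"
  using GL_carrier[of A n] mat_inv(1)[of A n] by (simp add: parabolic_def)

lemma inj_on_parabolic: "inj_on (\<lambda>(A, B). parabolic n A B) (GL n \<times> Alt n)"
proof (rule inj_onI, clarify)
  fix A B A' B' :: "'a mat"
  assume h: "A \<in> GL n" "B \<in> Alt n" "A' \<in> GL n" "B' \<in> Alt n" "parabolic n A B = parabolic n A' B'"
  note c = GL_carrier[OF h(1)] GL_carrier[OF h(3)] mat_inv(1)[OF h(1)] mat_inv(1)[OF h(3)] Alt_D(1)[OF h(2)] Alt_D(1)[OF h(4)]
  have "A = A'" "A * B = A' * B'"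
    using h(5) c by (auto simp: parabolic_def four_block_eq_iff[of _ n n _ n _ n])
  then show "A = A' \<and> B = B'" using GL_left_cancel(1)[OF h(1) c(5)] GL_left_cancel(1)[OF h(1) c(6)] by auto
qed

text \<open>P is the stabiliser in the orthogonal group of the totally singular subspace spanned by
  the first n basis vectors. For blocks A, X, 0, Y, orthogonality says that A^t Y = 1 and that X^t Y
  is alternating; so Y is determined by A, and B has to be A^-1 X.\<close>

lemma P_plus_iff_Oplus:
  assumes c2: "(1 :: 'a::field) + 1 = 0"
  shows "P_plus n = {w \<in> Oplus n. blk w n 0 n n = (0\<^sub>m n n :: 'a mat)}"
proof (intro equalityI subsetI)
  fix w :: "'a mat" assume "w \<in> P_plus n"
  then obtain A B where w: "w = parabolic n A B" "A \<in> GL n" "B \<in> Alt n" by (auto simp: P_plus_eq)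
  note c = GL_carrier[OF w(2)] mat_inv[OF w(2)] Alt_D(1,2)[OF w(3)]
  have A1: "transpose_mat A * transpose_mat (mat_inv A) = 1\<^sub>m n"
    using c by (simp add: transpose_mult[symmetric, of _ n n _ n])
  have "transpose_mat (A * B) * transpose_mat (mat_inv A) = transpose_mat (mat_inv A * (A * B))"
    using c by (subst transpose_mult[of "mat_inv A" n n "A * B" n]) auto
  then have "transpose_mat (A * B) * transpose_mat (mat_inv A) = B"
    using GL_left_cancel(1)[OF w(2) c(5)] c by simp
  moreover have "1\<^sub>m n + 1\<^sub>m n = (0\<^sub>m n n :: 'a mat)" by (rule eq_matI) (use c2 in auto)
  ultimately have "w \<in> Oplus n"
    using c w(3) A1 by (simp add: w(1) parabolic_def four_block_Oplus_iff[OF c2] zero_Alt)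
  moreover have "blk w n 0 n n = 0\<^sub>m n n" using c by (simp add: w(1) parabolic_def blk_four_block[of _ n n _ n _ n])
  ultimately show "w \<in> {w \<in> Oplus n. blk w n 0 n n = 0\<^sub>m n n}" by simp
next
  note c2' = add_self_eq_0[OF c2]
  fix w :: "'a mat" assume "w \<in> {w \<in> Oplus n. blk w n 0 n n = 0\<^sub>m n n}"
  then have w: "w \<in> Oplus n" "w \<in> carrier_mat (n + n) (n + n)" "blk w n 0 n n = 0\<^sub>m n n" by (auto simp: Oplus_def)
  define A X Y where "A = blk w 0 0 n n" "X = blk w 0 n n n" "Y = blk w n n n n"
  have c: "A \<in> carrier_mat n n" "X \<in> carrier_mat n n" "Y \<in> carrier_mat n n" by (simp_all add: A_X_Y_def)
  have weq: "w = four_block_mat A X (0\<^sub>m n n) Y" using four_block_blk[OF w(2)] w(3) by (simp add: A_X_Y_def)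
  have XY: "transpose_mat X * Y \<in> Alt n" and "0\<^sub>m n n = transpose_mat (transpose_mat A * Y + 1\<^sub>m n)"
    using w(1) c by (auto simp: weq four_block_Oplus_iff[OF c2])
  then have AY0: "transpose_mat A * Y + 1\<^sub>m n = 0\<^sub>m n n" by (metis transpose_transpose zero_transpose_mat)
  have "transpose_mat A * Y = 1\<^sub>m n"
  proof (rule eq_matI)
    fix i j assume ij: "i < dim_row (1\<^sub>m n :: 'a mat)" "j < dim_col (1\<^sub>m n :: 'a mat)"
    then have "(transpose_mat A * Y) $$ (i, j) + 1\<^sub>m n $$ (i, j) = 0"
      using c arg_cong[OF AY0, of "\<lambda>M. M $$ (i, j)"] by simp
    then show "(transpose_mat A * Y) $$ (i, j) = 1\<^sub>m n $$ (i, j)"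
      using c2'[of "1\<^sub>m n $$ (i, j)"] by (metis add_right_cancel)
  qed (use c in auto)
  then have AY: "transpose_mat A \<in> GL n" "mat_inv (transpose_mat A) = Y"
    using c by (auto intro: GL_I[of _ n Y] mat_inv_unique[of _ n])
  then have A: "A \<in> GL n" using transpose_GL[of "transpose_mat A" n] by simp
  have Y: "transpose_mat (mat_inv A) = Y" using AY(2) transpose_mat_inv[OF A] by simp
  define B where "B = mat_inv A * X"
  \<comment> \<open>Since Y^t = A^-1, the matrix A^-1 X is the transpose of the alternating matrix
    X^t Y.\<close>
  have "transpose_mat (transpose_mat X * Y) = B"
    using c mat_inv(1)[OF A] unfolding B_def Y[symmetric] by (subst transpose_mult[of _ n n _ n]) auto
  then have "B \<in> Alt n" using XY Alt_D(2)[OF XY] by simp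
  moreover have "A * B = X" using GL_left_cancel(2)[OF A c(2)] by (simp add: B_def)
  ultimately show "w \<in> P_plus n"
    unfolding P_plus_eq using A Y by (intro image_eqI[where x = "(A, B)"]) (auto simp: weq parabolic_def)
qed

lemma parabolic_GL:
  assumes A: "A \<in> GL n" and B: "B \<in> Alt n"
  shows "parabolic n A B \<in> GL (n + n)"
proof -
  note c = GL_carrier[OF A] mat_inv[OF A] Alt_D(1)[OF B]
  have "det (parabolic n A B) = det A * det (transpose_mat (mat_inv A))"
    using c by (simp add: parabolic_def det_four_block_mat_lower_left_zero[of _ n _ n])
  then show ?thesis
    using parabolic_carrier[OF A] A transpose_GL[OF mat_inv_GL[OF A]] by (simp add: GL_iff_det)
qed

lemma subgroup_P_plus:
  assumes c2: "(1 :: 'a::{field,finite}) + 1 = 0"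
  shows "subgroup (P_plus n) (GL_group (n + n) :: 'a mat monoid)" "finite (P_plus n :: 'a mat set)"
proof -
  interpret group "GL_group (n + n) :: 'a mat monoid" by (rule group_GL)
  show fin: "finite (P_plus n :: 'a mat set)" by (simp add: P_plus_eq finite_GL finite_Alt)
  have sub: "P_plus n \<subseteq> (GL (n + n) :: 'a mat set)" by (auto simp: P_plus_eq parabolic_GL)
  have mult: "w * v \<in> P_plus n" if wv: "w \<in> P_plus n" "v \<in> P_plus n" for w v :: "'a mat"
  proof -
    have wO: "w \<in> Oplus n" "v \<in> Oplus n" using wv by (auto simp: P_plus_iff_Oplus[OF c2])
    obtain A B A' B' where p: "w = parabolic n A B" "A \<in> GL n" "B \<in> Alt n" "v = parabolic n A' B'" "A' \<in> GL n" "B' \<in> Alt n"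
      using wv by (auto simp: P_plus_eq)
    note c = GL_carrier[OF p(2)] GL_carrier[OF p(5)] mat_inv(1)[OF p(2)] mat_inv(1)[OF p(5)] Alt_D(1)[OF p(3)] Alt_D(1)[OF p(6)]
    have "blk (w * v) n 0 n n = 0\<^sub>m n n"
      unfolding p(1,4) parabolic_def using c
      by (subst mult_four_block_mat[of _ n n _ n _ n _ _ n _ n], simp_all) (subst blk_four_block(3)[of _ n n _ n _ n], auto)
    then show ?thesis using mult_Oplus[OF c2 wO] by (simp add: P_plus_iff_Oplus[OF c2])
  qed
  have one: "1\<^sub>m (n + n) \<in> (P_plus n :: 'a mat set)"
  proof -
    have "mat_inv (1\<^sub>m n) = (1\<^sub>m n :: 'a mat)" by (rule mat_inv_unique) auto
    then have "1\<^sub>m (n + n) = parabolic n (1\<^sub>m n) (0\<^sub>m n n :: 'a mat)" by (simp add: parabolic_def)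
    then show ?thesis unfolding P_plus_eq using one_GL zero_Alt by (intro image_eqI[where x = "(1\<^sub>m n, 0\<^sub>m n n)"]) auto
  qed
  show "subgroup (P_plus n) (GL_group (n + n) :: 'a mat monoid)"
  proof (rule subgroupI)
    fix w :: "'a mat" assume w: "w \<in> P_plus n"
    then have wG: "w \<in> GL (n + n)" using sub by auto
    \<comment> \<open>Closure under inverses comes from finiteness: left multiplication by w is
      injective on P, hence onto, and so reaches the identity.\<close>
    have "(\<lambda>v. w * v) ` P_plus n = P_plus n"
    proof (rule endo_inj_surj[OF fin])
      show "inj_on (\<lambda>v. w * v) (P_plus n)"
        by (rule inj_on_inverseI[where g = "\<lambda>v. mat_inv w * v"])
          (use GL_left_cancel(1)[OF wG] sub GL_carrier in blast)
    qed (use w mult in auto)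
    then obtain v where v: "v \<in> P_plus n" "w * v = 1\<^sub>m (n + n)" using one by (metis imageE)
    then have "mat_inv w = v" using wG sub by (intro mat_inv_unique) (auto dest: GL_carrier)
    then show "inv\<^bsub>GL_group (n + n)\<^esub> w \<in> P_plus n" using v(1) by (simp add: inv_GL_group[OF wG])
  qed (use sub mult one in \<open>auto simp: GL_group_def\<close>)
qed

section \<open>The stabiliser of the double coset representative\<close>

text \<open>The coordinate projections from which \<sigma> is built. Writing n as s + k removes the
  subtraction in \<open>sigma_plus\<close>, and products with \<sigma> reduce to selecting block
  rows and columns.\<close>

definition projE :: "nat \<Rightarrow> nat \<Rightarrow> 'a::field mat" where
  "projE s k = four_block_mat (1\<^sub>m s) (0\<^sub>m s k) (0\<^sub>m k s) (0\<^sub>m k k)"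

definition projD :: "nat \<Rightarrow> nat \<Rightarrow> 'a::field mat" where
  "projD s k = four_block_mat (0\<^sub>m s s) (0\<^sub>m s k) (0\<^sub>m k s) (1\<^sub>m k)"

lemma proj_carrier[simp]: "projE s k \<in> carrier_mat (s + k) (s + k)" "projD s k \<in> carrier_mat (s + k) (s + k)"
  by (simp_all add: projE_def projD_def)

lemma sigma_plus_eq: "sigma_plus (s + k) s = four_block_mat (projD s k) (projE s k) (projE s k) (projD s k)"
  by (simp add: sigma_plus_def projE_def projD_def Let_def)

lemma sigma_plus_carrier: "sigma_plus (s + k) s \<in> carrier_mat (s + k + (s + k)) (s + k + (s + k))"
  unfolding sigma_plus_eq by (rule four_block_carrier_mat) auto

lemma proj_mult:
  assumes "A1 \<in> carrier_mat s s" "A2 \<in> carrier_mat s k" "A3 \<in> carrier_mat k s" "A4 \<in> carrier_mat k k"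
  shows "projE s k * four_block_mat A1 A2 A3 A4 = four_block_mat A1 A2 (0\<^sub>m k s) (0\<^sub>m k k)"
    and "projD s k * four_block_mat A1 A2 A3 A4 = four_block_mat (0\<^sub>m s s) (0\<^sub>m s k) A3 A4"
    and "four_block_mat A1 A2 A3 A4 * projE s k = four_block_mat A1 (0\<^sub>m s k) A3 (0\<^sub>m k k)"
    and "four_block_mat A1 A2 A3 A4 * projD s k = four_block_mat (0\<^sub>m s s) A2 (0\<^sub>m k s) A4"
  using assms by (simp_all add: projE_def projD_def mult_four_block_mat[of _ s s _ k _ k _ _ s _ k])

lemma proj_mult_proj:
  "projE s k * projE s k = projE s k" "projD s k * projD s k = projD s k"
  "projE s k * projD s k = 0\<^sub>m (s + k) (s + k)" "projD s k * projE s k = 0\<^sub>m (s + k) (s + k)"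
  using proj_mult[of "1\<^sub>m s" s "0\<^sub>m s k" k "0\<^sub>m k s" "0\<^sub>m k k"] proj_mult[of "0\<^sub>m s s" s "0\<^sub>m s k" k "0\<^sub>m k s" "1\<^sub>m k"]
  unfolding projE_def[symmetric] projD_def[symmetric] by (simp_all add: four_block_zero_mat)

lemma proj_add:
  "projE s k + projD s k = 1\<^sub>m (s + k)" "projD s k + projE s k = 1\<^sub>m (s + k)"
  by (simp_all add: projE_def projD_def add_four_block_mat[of _ s s _ k _ k])

lemma proj_transpose: "transpose_mat (projE s k) = projE s k" "transpose_mat (projD s k) = projD s k"
  by (simp_all add: projE_def projD_def transpose_four_block_mat[of _ s s _ k _ k])

lemma sigma_plus_square: "sigma_plus (s + k) s * sigma_plus (s + k) s = 1\<^sub>m (s + k + (s + k))"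
  unfolding sigma_plus_eq
  by (subst mult_four_block_mat[of _ "s + k" "s + k" _ "s + k" _ "s + k" _ _ "s + k" _ "s + k"])
    (simp_all add: proj_mult_proj proj_add)

lemma sigma_plus_GL: "sigma_plus (s + k) s \<in> GL (s + k + (s + k))"
  by (rule GL_I[OF sigma_plus_carrier sigma_plus_carrier sigma_plus_square])

lemma sigma_plus_Oplus:
  assumes c2: "(1 :: 'a::field) + 1 = 0"
  shows "(sigma_plus (s + k) s :: 'a mat) \<in> Oplus (s + k)"
proof -
  have "1\<^sub>m k + 1\<^sub>m k = (0\<^sub>m k k :: 'a mat)" by (rule eq_matI) (use c2 in auto)
  then have "projD s k + 1\<^sub>m (s + k) = (projE s k :: 'a mat)"
    unfolding four_block_one_mat[symmetric]
    by (simp add: projE_def projD_def add_four_block_mat[of _ s s _ k _ k] del: four_block_one_mat)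
  then show ?thesis
    unfolding sigma_plus_eq
    by (simp add: four_block_Oplus_iff[OF c2] proj_mult_proj proj_transpose zero_Alt)
qed

lemma sigma_plus_mult:
  fixes A X Y :: "'a::field mat"
  assumes "A \<in> carrier_mat (s + k) (s + k)" "X \<in> carrier_mat (s + k) (s + k)" "Y \<in> carrier_mat (s + k) (s + k)"
  shows "sigma_plus (s + k) s * four_block_mat A X (0\<^sub>m (s + k) (s + k)) Y =
    four_block_mat (projD s k * A) (projD s k * X + projE s k * Y) (projE s k * A) (projE s k * X + projD s k * Y)"
proof -
  have "projE s k * 0\<^sub>m (s + k) (s + k) = (0\<^sub>m (s + k) (s + k) :: 'a mat)"
    "projD s k * 0\<^sub>m (s + k) (s + k) = (0\<^sub>m (s + k) (s + k) :: 'a mat)"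
    by (auto intro: right_mult_zero_mat)
  moreover have "projD s k * A \<in> carrier_mat (s + k) (s + k)" "projE s k * A \<in> carrier_mat (s + k) (s + k)"
    by (rule mult_carrier_mat[OF _ assms(1)], simp)+
  ultimately show ?thesis
    unfolding sigma_plus_eq using assms
    by (subst mult_four_block_mat[of _ "s + k" "s + k" _ "s + k" _ "s + k" _ _ "s + k" _ "s + k"]) simp_all
qed

text \<open>This is the only block of the conjugate that decides membership in P. Its entries are E
  X E, E A D and D Y E, for E = \<open>projE s k\<close> and D = \<open>projD s k\<close>.\<close>

lemma sigma_plus_conj_lower_left:
  assumes A: "A1 \<in> carrier_mat s s" "A2 \<in> carrier_mat s k" "A3 \<in> carrier_mat k s" "A4 \<in> carrier_mat k k"
    and X: "X1 \<in> carrier_mat s s" "X2 \<in> carrier_mat s k" "X3 \<in> carrier_mat k s" "X4 \<in> carrier_mat k k"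
    and Y: "Y1 \<in> carrier_mat s s" "Y2 \<in> carrier_mat s k" "Y3 \<in> carrier_mat k s" "Y4 \<in> carrier_mat k k"
  shows "blk (sigma_plus (s + k) s * four_block_mat (four_block_mat A1 A2 A3 A4) (four_block_mat X1 X2 X3 X4)
      (0\<^sub>m (s + k) (s + k)) (four_block_mat Y1 Y2 Y3 Y4) * sigma_plus (s + k) s) (s + k) 0 (s + k) (s + k)
    = four_block_mat X1 A2 Y3 (0\<^sub>m k k)"
proof -
  let ?n = "s + k"
  let ?A = "four_block_mat A1 A2 A3 A4" and ?X = "four_block_mat X1 X2 X3 X4" and ?Y = "four_block_mat Y1 Y2 Y3 Y4"
  have c: "?A \<in> carrier_mat ?n ?n" "?X \<in> carrier_mat ?n ?n" "?Y \<in> carrier_mat ?n ?n" using A X Y by auto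
  let ?P = "projD s k * ?A" and ?Q = "projD s k * ?X + projE s k * ?Y"
    and ?R = "projE s k * ?A" and ?S = "projE s k * ?X + projD s k * ?Y"
  have c': "?P \<in> carrier_mat ?n ?n" "?Q \<in> carrier_mat ?n ?n" "?R \<in> carrier_mat ?n ?n" "?S \<in> carrier_mat ?n ?n"
    using c by (auto intro!: add_carrier_mat mult_carrier_mat[of _ ?n ?n])
  have "blk (four_block_mat ?P ?Q ?R ?S * sigma_plus ?n s) ?n 0 ?n ?n = ?R * projD s k + ?S * projE s k"
    unfolding sigma_plus_eq mult_four_block_mat[OF c' proj_carrier(2) proj_carrier(1) proj_carrier(1) proj_carrier(2)]
    by (rule blk_four_block(3)[of _ ?n ?n _ ?n _ ?n])
      (use c' in \<open>auto intro!: add_carrier_mat mult_carrier_mat[of _ ?n ?n]\<close>)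
  also have "\<dots> = four_block_mat X1 A2 Y3 (0\<^sub>m k k)"
    using A X Y by (simp add: proj_mult add_four_block_mat[of _ s s _ k _ k])
  finally show ?thesis by (simp only: sigma_plus_mult[OF c])
qed

definition lower_tri :: "nat \<Rightarrow> nat \<Rightarrow> 'a::field mat \<Rightarrow> 'a mat \<Rightarrow> 'a mat \<Rightarrow> 'a mat" where
  "lower_tri s k A1 A3 A4 = four_block_mat A1 (0\<^sub>m s k) A3 A4"

lemma lower_tri_GL_iff:
  assumes "A1 \<in> carrier_mat s s" "A3 \<in> carrier_mat k s" "A4 \<in> carrier_mat k k"
  shows "lower_tri s k A1 A3 A4 \<in> GL (s + k) \<longleftrightarrow> A1 \<in> GL s \<and> A4 \<in> GL k"
  using assms by (auto simp: lower_tri_def GL_iff_det det_four_block_mat_upper_right_zero[of _ s _ k])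

text \<open>Only the shape and the diagonal blocks of the inverse matter below, so the block Z is
  left unspecified.\<close>

lemma mat_inv_lower_tri:
  fixes A1 A3 A4 :: "'a::field mat"
  assumes A1: "A1 \<in> GL s" and A3: "A3 \<in> carrier_mat k s" and A4: "A4 \<in> GL k"
  obtains Z where "Z \<in> carrier_mat k s" "mat_inv (lower_tri s k A1 A3 A4) = lower_tri s k (mat_inv A1) Z (mat_inv A4)"
proof -
  let ?L = "lower_tri s k A1 A3 A4"
  note c = GL_carrier[OF A1] GL_carrier[OF A4]
  have L: "?L \<in> GL (s + k)" using A1 A3 A4 c by (simp add: lower_tri_GL_iff)
  define W where "W = mat_inv ?L"
  have W: "W \<in> carrier_mat (s + k) (s + k)" using mat_inv(1)[OF L] by (simp add: W_def)
  define Z1 Z2 Z3 Z4 where Z: "Z1 = blk W 0 0 s s" "Z2 = blk W 0 s s k" "Z3 = blk W s 0 k s" "Z4 = blk W s s k k"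
  have cz: "Z1 \<in> carrier_mat s s" "Z2 \<in> carrier_mat s k" "Z3 \<in> carrier_mat k s" "Z4 \<in> carrier_mat k k" by (simp_all add: Z)
  have Weq: "W = four_block_mat Z1 Z2 Z3 Z4" using four_block_blk[OF W] by (simp add: Z)
  have "?L * W = four_block_mat (1\<^sub>m s) (0\<^sub>m s k) (0\<^sub>m k s) (1\<^sub>m k)"
    using mat_inv(2)[OF L] by (simp add: W_def)
  also have "?L * W = four_block_mat (A1 * Z1 + 0\<^sub>m s k * Z3) (A1 * Z2 + 0\<^sub>m s k * Z4) (A3 * Z1 + A4 * Z3) (A3 * Z2 + A4 * Z4)"
    unfolding Weq lower_tri_def using c A3 cz by (intro mult_four_block_mat[of _ s s _ k _ k _ _ s _ k]) auto
  finally have "A1 * Z1 + 0\<^sub>m s k * Z3 = 1\<^sub>m s \<and> A1 * Z2 + 0\<^sub>m s k * Z4 = 0\<^sub>m s k \<and> A3 * Z1 + A4 * Z3 = 0\<^sub>m k s \<and> A3 * Z2 + A4 * Z4 = 1\<^sub>m k"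
    by (subst (asm) four_block_eq_iff[of _ s s _ k _ k])
      (use c A3 cz in \<open>auto intro!: add_carrier_mat intro: mult_carrier_mat\<close>)
  then have e: "A1 * Z1 = 1\<^sub>m s" "A1 * Z2 = 0\<^sub>m s k" "A3 * Z2 + A4 * Z4 = 1\<^sub>m k" using c cz by auto
  have Z2: "Z2 = 0\<^sub>m s k" using GL_left_cancel(1)[OF A1 cz(2)] e(2) mat_inv(1)[OF A1] by simp
  then have "A4 * Z4 = 1\<^sub>m k" using e(3) A3 c cz by simp
  then have "mat_inv A1 = Z1" "mat_inv A4 = Z4" using e(1) c cz by (auto intro: mat_inv_unique)
  then show thesis using that[of Z3] cz Weq Z2 by (simp add: W_def lower_tri_def)
qed

lemma lower_tri_inject:
  assumes "A1 \<in> carrier_mat s s" "A3 \<in> carrier_mat k s" "A4 \<in> carrier_mat k k"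
    and "B1 \<in> carrier_mat s s" "B3 \<in> carrier_mat k s" "B4 \<in> carrier_mat k k"
  shows "lower_tri s k A1 A3 A4 = lower_tri s k B1 B3 B4 \<longleftrightarrow> A1 = B1 \<and> A3 = B3 \<and> A4 = B4"
  using assms by (simp add: lower_tri_def four_block_eq_iff[of _ s s _ k _ k])

lemma inj_on_lower_tri:
  assumes "S \<subseteq> GL s"
  shows "inj_on (\<lambda>(A1, A3, A4). lower_tri s k A1 A3 A4) (S \<times> carrier_mat k s \<times> GL k)"
proof -
  have c: "A \<in> carrier_mat s s" if "A \<in> S" for A
    using that assms by (auto intro: GL_carrier)
  then show ?thesis by (intro inj_onI) (auto simp: lower_tri_inject GL_carrier)
qed

lemma AltZ_iff: "B \<in> AltZ (s + k) s \<longleftrightarrow> B \<in> Alt (s + k) \<and> blk B 0 0 s s = 0\<^sub>m s s"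
  by (auto simp: AltZ_def mat_eq_iff)

text \<open>The conjugate is orthogonal in any case, so it lies in P iff X1 = 0, A2 = 0 and Y3 = 0.
  Here A2 = 0 makes A lower triangular; then X1 = A1 B1 with A1 invertible, so X1 = 0 means B1 = 0,
  and Y3 = 0 holds because the inverse transpose of A is upper triangular.\<close>

lemma P_plus_conj_sigma:
  assumes c2: "(1 :: 'a::field) + 1 = 0"
  shows "{h \<in> P_plus (s + k). sigma_plus (s + k) s * h * sigma_plus (s + k) s \<in> P_plus (s + k)} =
    (\<lambda>(A, B). parabolic (s + k) A B) `
      ((\<lambda>(A1, A3, A4). lower_tri s k A1 A3 A4) ` (GL s \<times> carrier_mat k s \<times> GL k) \<times> (AltZ (s + k) s :: 'a mat set))"
proof -
  let ?n = "s + k" and ?\<sigma> = "sigma_plus (s + k) s :: 'a mat"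
  let ?LT = "(\<lambda>(A1, A3, A4). lower_tri s k A1 A3 A4) ` (GL s \<times> carrier_mat k s \<times> GL k) :: 'a mat set"
  have LT: "?LT \<subseteq> GL ?n" by (auto simp: lower_tri_GL_iff GL_carrier)
  have "?\<sigma> * parabolic ?n A B * ?\<sigma> \<in> P_plus ?n \<longleftrightarrow> A \<in> ?LT \<and> B \<in> AltZ ?n s"
    if A: "A \<in> GL ?n" and B: "B \<in> Alt ?n" for A B
  proof -
    define A1 A2 A3 A4 where A_def: "A1 = blk A 0 0 s s" "A2 = blk A 0 s s k" "A3 = blk A s 0 k s" "A4 = blk A s s k k"
    define B1 B2 B3 B4 where B_def: "B1 = blk B 0 0 s s" "B2 = blk B 0 s s k" "B3 = blk B s 0 k s" "B4 = blk B s s k k"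
    define Y where "Y = transpose_mat (mat_inv A)"
    define Y1 Y2 Y3 Y4 where Y_defs: "Y1 = blk Y 0 0 s s" "Y2 = blk Y 0 s s k" "Y3 = blk Y s 0 k s" "Y4 = blk Y s s k k"
    have Yc: "Y \<in> carrier_mat ?n ?n" using mat_inv(1)[OF A] by (simp add: Y_def)
    have ca: "A1 \<in> carrier_mat s s" "A2 \<in> carrier_mat s k" "A3 \<in> carrier_mat k s" "A4 \<in> carrier_mat k k" by (simp_all add: A_def)
    have cb: "B1 \<in> carrier_mat s s" "B2 \<in> carrier_mat s k" "B3 \<in> carrier_mat k s" "B4 \<in> carrier_mat k k" by (simp_all add: B_def)
    have cy: "Y1 \<in> carrier_mat s s" "Y2 \<in> carrier_mat s k" "Y3 \<in> carrier_mat k s" "Y4 \<in> carrier_mat k k" by (simp_all add: Y_defs)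
    have Aeq: "A = four_block_mat A1 A2 A3 A4" using four_block_blk[OF GL_carrier[OF A]] by (simp add: A_def)
    have Beq: "B = four_block_mat B1 B2 B3 B4" using four_block_blk[OF Alt_D(1)[OF B]] by (simp add: B_def)
    have Yeq: "Y = four_block_mat Y1 Y2 Y3 Y4" using four_block_blk[OF Yc] by (simp add: Y_defs)
    define X1 X2 X3 X4 where X_def: "X1 = A1 * B1 + A2 * B3" "X2 = A1 * B2 + A2 * B4" "X3 = A3 * B1 + A4 * B3" "X4 = A3 * B2 + A4 * B4"
    have cx: "X1 \<in> carrier_mat s s" "X2 \<in> carrier_mat s k" "X3 \<in> carrier_mat k s" "X4 \<in> carrier_mat k k"
      unfolding X_def by (rule add_carrier_mat mult_carrier_mat[OF ca(2) cb(3)] mult_carrier_mat[OF ca(2) cb(4)]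
        mult_carrier_mat[OF ca(4) cb(3)] mult_carrier_mat[OF ca(4) cb(4)])+
    have AB: "A * B = four_block_mat X1 X2 X3 X4"
      unfolding X_def Aeq Beq by (rule mult_four_block_mat[OF ca cb])
    have "parabolic ?n A B \<in> P_plus ?n" using A B by (auto simp: P_plus_eq)
    then have "parabolic ?n A B \<in> Oplus ?n" using P_plus_iff_Oplus[OF c2, of ?n] by blast
    then have "?\<sigma> * parabolic ?n A B * ?\<sigma> \<in> Oplus ?n"
      by (intro mult_Oplus[OF c2] sigma_plus_Oplus[OF c2])
    moreover have "blk (?\<sigma> * parabolic ?n A B * ?\<sigma>) ?n 0 ?n ?n = four_block_mat X1 A2 Y3 (0\<^sub>m k k)"
      using sigma_plus_conj_lower_left[OF ca cx cy]
      by (simp only: Aeq[symmetric] AB[symmetric] Yeq[symmetric] Y_def parabolic_def)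
    ultimately have "?\<sigma> * parabolic ?n A B * ?\<sigma> \<in> P_plus ?n \<longleftrightarrow> four_block_mat X1 A2 Y3 (0\<^sub>m k k) = 0\<^sub>m ?n ?n"
      by (simp add: P_plus_iff_Oplus[OF c2])
    also have "\<dots> \<longleftrightarrow> X1 = 0\<^sub>m s s \<and> A2 = 0\<^sub>m s k \<and> Y3 = 0\<^sub>m k s"
      unfolding four_block_zero_mat[symmetric] using ca cx cy by (simp add: four_block_eq_iff[of _ s s _ k _ k] del: four_block_zero_mat)
    also have "\<dots> \<longleftrightarrow> A \<in> ?LT \<and> B \<in> AltZ ?n s"
    proof
      assume h: "X1 = 0\<^sub>m s s \<and> A2 = 0\<^sub>m s k \<and> Y3 = 0\<^sub>m k s"
      then have Al: "A = lower_tri s k A1 A3 A4" by (simp add: Aeq lower_tri_def)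
      then have G: "A1 \<in> GL s" "A4 \<in> GL k" using A lower_tri_GL_iff[OF ca(1,3,4)] by auto
      have A2: "A2 = 0\<^sub>m s k" and X1: "X1 = 0\<^sub>m s s" using h by auto
      have "A1 * B1 = 0\<^sub>m s s" using X1 ca cb unfolding X_def A2 by simp
      then have "B1 = 0\<^sub>m s s" using GL_left_cancel(1)[OF G(1) cb(1)] mat_inv(1)[OF G(1)] by simp
      moreover have "A \<in> ?LT" using G ca Al by (intro image_eqI[where x = "(A1, A3, A4)"]) auto
      ultimately show "A \<in> ?LT \<and> B \<in> AltZ ?n s" using B by (simp add: AltZ_iff B_def)
    next
      assume h: "A \<in> ?LT \<and> B \<in> AltZ ?n s"
      then obtain C1 C3 C4 where C: "C1 \<in> GL s" "C3 \<in> carrier_mat k s" "C4 \<in> GL k" "A = lower_tri s k C1 C3 C4" by auto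
      note cc = GL_carrier[OF C(1)] GL_carrier[OF C(3)]
      have A2: "A2 = 0\<^sub>m s k" using C cc by (simp add: A_def(2) lower_tri_def blk_four_block[of _ s s _ k _ k])
      have "B1 = 0\<^sub>m s s" using h by (simp add: AltZ_iff B_def)
      then have "X1 = 0\<^sub>m s s" using A2 ca cb by (simp add: X_def)
      moreover obtain Z where Z: "Z \<in> carrier_mat k s" "mat_inv A = lower_tri s k (mat_inv C1) Z (mat_inv C4)"
        using mat_inv_lower_tri[OF C(1,2,3)] C(4) by metis
      then have "Y = four_block_mat (transpose_mat (mat_inv C1)) (transpose_mat Z) (0\<^sub>m k s) (transpose_mat (mat_inv C4))"
        unfolding Y_def Z(2) lower_tri_def using mat_inv(1)[OF C(1)] mat_inv(1)[OF C(3)]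
        by (simp add: transpose_four_block_mat[of _ s s _ k _ k])
      then have "Y3 = 0\<^sub>m k s" using Z(1) mat_inv(1)[OF C(1)] mat_inv(1)[OF C(3)]
        by (simp add: Y_defs(3) blk_four_block[of _ s s _ k _ k])
      ultimately show "X1 = 0\<^sub>m s s \<and> A2 = 0\<^sub>m s k \<and> Y3 = 0\<^sub>m k s" using A2 by simp
    qed
    finally show ?thesis .
  qed
  note iff = this
  have sub: "?LT \<times> AltZ ?n s \<subseteq> GL ?n \<times> Alt ?n"
    by (rule Sigma_mono[OF LT]) (auto simp: AltZ_def)
  have "?\<sigma> * h * ?\<sigma> \<in> P_plus ?n \<longleftrightarrow> h \<in> (\<lambda>(A, B). parabolic ?n A B) ` (?LT \<times> AltZ ?n s)" if "h \<in> P_plus ?n" for h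
  proof -
    obtain A B where h: "h = parabolic ?n A B" "A \<in> GL ?n" "B \<in> Alt ?n"
      using \<open>h \<in> P_plus ?n\<close> by (auto simp: P_plus_eq)
    \<comment> \<open>Uniqueness of the coordinates turns membership in the image into membership of
      (A, B) itself.\<close>
    have "(\<lambda>(A, B). parabolic ?n A B) (A, B) \<in> (\<lambda>(A, B). parabolic ?n A B) ` (?LT \<times> AltZ ?n s)
        \<longleftrightarrow> (A, B) \<in> ?LT \<times> AltZ ?n s"
      using h sub by (intro inj_on_image_mem_iff[OF inj_on_parabolic]) auto
    then show ?thesis using iff[OF h(2,3)] by (simp add: h(1))
  qed
  moreover have "(\<lambda>(A, B). parabolic ?n A B) ` (?LT \<times> AltZ ?n s) \<subseteq> P_plus ?n"
    unfolding P_plus_eq by (rule image_mono[OF sub])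
  ultimately have "h \<in> P_plus ?n \<and> ?\<sigma> * h * ?\<sigma> \<in> P_plus ?n \<longleftrightarrow>
      h \<in> (\<lambda>(A, B). parabolic ?n A B) ` (?LT \<times> AltZ ?n s)" for h
    by (meson in_mono)
  then show ?thesis by (rule Set.set_eqI[OF trans[OF mem_Collect_eq]])
qed

section \<open>The character sum over a double coset\<close>

lemma mat_trace_add:
  "A \<in> carrier_mat n n \<Longrightarrow> B \<in> carrier_mat n n \<Longrightarrow> mat_trace (A + B) = mat_trace A + mat_trace B"
  by (simp add: mat_trace_def sum.distrib)

lemma mat_trace_mult_unit:
  fixes M :: "'a::comm_semiring_0 mat"
  assumes "M \<in> carrier_mat n n" "i < n" "j < n"
  shows "mat_trace (M * mat n n (\<lambda>x. if x = (j, i) then c else 0)) = M $$ (i, j) * c"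
proof -
  have "(M * mat n n (\<lambda>x. if x = (j, i) then c else 0)) $$ (l, l) = (if l = i then M $$ (i, j) * c else 0)" if "l < n" for l
  proof -
    have "(M * mat n n (\<lambda>x. if x = (j, i) then c else 0)) $$ (l, l) = (\<Sum>t\<in>{0..<n}. M $$ (l, t) * (if (t, l) = (j, i) then c else 0))"
      using assms that by (simp add: scalar_prod_def)
    also have "\<dots> = (\<Sum>t\<in>{0..<n}. if t = j then if l = i then M $$ (i, j) * c else 0 else 0)"
      by (rule sum.cong[OF refl]) auto
    finally show ?thesis using assms by simp
  qed
  then have "mat_trace (M * mat n n (\<lambda>x. if x = (j, i) then c else 0)) = (\<Sum>l<n. if l = i then M $$ (i, j) * c else 0)"
    using assms by (auto simp: mat_trace_def intro!: sum.cong)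
  then show ?thesis using assms by simp
qed

lemma mat_trace_mult_symmetrisation:
  fixes M C :: "'a::comm_ring_1 mat"
  assumes "M \<in> carrier_mat n n" "C \<in> carrier_mat n n"
  shows "mat_trace (M * (C + transpose_mat C)) = mat_trace (M * C) + mat_trace (transpose_mat M * C)"
proof -
  have "M * (C + transpose_mat C) = M * C + M * transpose_mat C"
    using assms by (intro mult_add_distrib_mat[of _ n n]) auto
  moreover have "mat_trace (M * transpose_mat C) = mat_trace (C * transpose_mat M)"
    using assms mat_trace_transpose[of "C * transpose_mat M" n] by (simp add: transpose_mult[of _ n n _ n])
  moreover have "mat_trace (C * transpose_mat M) = mat_trace (transpose_mat M * C)"
    using assms by (intro mat_trace_comm[of _ n n]) auto
  ultimately show ?thesis using assms by (simp add: mat_trace_add[of _ n])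
qed

text \<open>From tr(M(C + C^t)) = tr(MC) + tr(M^t C), a symmetric M pairs to zero with every
  alternating matrix. Otherwise B \<mapsto> tr(MB) is not constant, and a suitable shift of B shows
  that the sum vanishes.\<close>

lemma sum_character_Alt:
  fixes \<psi> :: "'a::{field,finite} \<Rightarrow> complex"
  assumes c2: "(1 :: 'a) + 1 = 0" and \<psi>: "nontrivial_additive_character \<psi>" and M: "M \<in> carrier_mat n n"
  shows "(\<Sum>B\<in>Alt n. \<psi> (mat_trace (M * B)))
    = (if transpose_mat M = M then of_nat (card (Alt n :: 'a mat set)) else 0)"
proof -
  note c2' = add_self_eq_0[OF c2]
  note add = additive_character[OF \<psi>]
  show ?thesis
  proof (cases "transpose_mat M = M")
    case True
    have "mat_trace (M * B) = 0" if B: "B \<in> Alt n" for B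
    proof -
      obtain C where "C \<in> carrier_mat n n" "B = C + transpose_mat C"
        using B unfolding Alt_eq_symmetrisation[OF c2] by blast
      then show ?thesis using mat_trace_mult_symmetrisation[OF M] True c2' by simp
    qed
    then show ?thesis using True add(2) by simp
  next
    case False
    then obtain i j where ij: "i < n" "j < n" "M $$ (j, i) \<noteq> M $$ (i, j)"
      using M by (auto simp: mat_eq_iff)
    \<comment> \<open>In characteristic 2 two entries differ exactly when their sum is
      nonzero.\<close>
    have "M $$ (i, j) + M $$ (j, i) \<noteq> 0"
      using ij(3) c2'[of "M $$ (i, j)"] by (metis add_left_cancel)
    then obtain x where x: "\<psi> (x * (M $$ (i, j) + M $$ (j, i))) \<noteq> 1"
      by (rule exists_character_ne_1[OF \<psi>])
    \<comment> \<open>The single entry x sits at (j, i), so that M * C picks out x M(i, j), and M^t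
      * C picks out x M(j, i).\<close>
    define C where "C = mat n n (\<lambda>y. if y = (j, i) then x else 0)"
    define B0 where "B0 = C + transpose_mat C"
    have C: "C \<in> carrier_mat n n" by (simp add: C_def)
    have B0: "B0 \<in> Alt n" unfolding B0_def Alt_eq_symmetrisation[OF c2] using C by blast
    have B0c: "B0 \<in> carrier_mat n n" by (rule Alt_D(1)[OF B0])
    have trB0: "mat_trace (M * B0) = x * (M $$ (i, j) + M $$ (j, i))"
      unfolding B0_def mat_trace_mult_symmetrisation[OF M C]
      using M ij mat_trace_mult_unit[OF M ij(1,2), of x] mat_trace_mult_unit[of "transpose_mat M" n i j x]
      by (simp add: C_def algebra_simps)
    have inv: "B + B0 + B0 = B" if "B \<in> Alt n" for B
      using Alt_D(1)[OF that] B0c by (intro eq_matI) (auto simp: add.assoc c2')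
    have "(\<Sum>B\<in>Alt n. \<psi> (mat_trace (M * B))) = 0"
    proof (rule sum_eq_0_if_shift[where t = "\<lambda>B. B + B0" and c = "\<psi> (mat_trace (M * B0))"])
      show "bij_betw (\<lambda>B. B + B0) (Alt n) (Alt n)"
        by (rule bij_betw_byWitness[where f' = "\<lambda>B. B + B0"]) (auto simp: inv add_Alt B0)
    next
      fix B :: "'a mat" assume "B \<in> Alt n"
      then have Bc: "B \<in> carrier_mat n n" by (rule Alt_D(1))
      have "M * (B + B0) = M * B + M * B0" by (rule mult_add_distrib_mat[OF M Bc B0c])
      then have "mat_trace (M * (B + B0)) = mat_trace (M * B0) + mat_trace (M * B)"
        using M Bc B0c by (simp add: mat_trace_add[of _ n] add.commute)
      then show "\<psi> (mat_trace (M * (B + B0))) = \<psi> (mat_trace (M * B0)) * \<psi> (mat_trace (M * B))"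
        by (simp add: add(1))
    qed (use x trB0 in simp)
    then show ?thesis using False by simp
  qed
qed

text \<open>Only the diagonal blocks of the product contribute. The matrix B enters linearly through
  \<open>projE s k * A * B\<close> alone, so the sum over B is a complete character sum.\<close>

lemma mat_trace_sigma_parabolic:
  assumes A: "A \<in> GL (s + k)" and B: "B \<in> Alt (s + k)"
  shows "mat_trace (sigma_plus (s + k) s * parabolic (s + k) A B) =
    mat_trace (projD s k * A) + mat_trace (projD s k * transpose_mat (mat_inv A)) + mat_trace (projE s k * A * B)"
proof -
  let ?n = "s + k"
  note c = GL_carrier[OF A] mat_inv(1)[OF A] Alt_D(1)[OF B]
  note pm = mult_carrier_mat[OF proj_carrier(1)[of s k]] mult_carrier_mat[OF proj_carrier(2)[of s k]]
  have AB: "A * B \<in> carrier_mat ?n ?n" using c by auto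
  have Y: "transpose_mat (mat_inv A) \<in> carrier_mat ?n ?n" using c by auto
  have "projE s k * (A * B) = projE s k * A * B"
    using c by (intro assoc_mult_mat[symmetric, of _ ?n ?n _ ?n _ ?n]) auto
  moreover have "projE s k * A * B \<in> carrier_mat ?n ?n" by (rule mult_carrier_mat[OF pm(1)[OF c(1)] c(3)])
  ultimately show ?thesis
    unfolding parabolic_def sigma_plus_mult[OF c(1) AB Y]
    using pm(2)[OF c(1)] pm(2)[OF Y]
    by (simp add: mat_trace_four_block[of _ ?n _ ?n] mat_trace_add[of _ ?n])
qed

text \<open>\<open>projE s k * A\<close> keeps the upper blocks A1, A2 and clears the rest, so its
  symmetry means A1 = A1^t and A2 = 0; then A is invertible iff A1 and A4 are.\<close>

lemma projE_mult_symmetric: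
  "{A \<in> GL (s + k). transpose_mat (projE s k * A) = projE s k * A} =
    (\<lambda>(A1, A3, A4). lower_tri s k A1 A3 A4) ` (SymGL s \<times> carrier_mat k s \<times> (GL k :: 'a::field mat set))"
proof (intro equalityI subsetI)
  have E: "projE s k * four_block_mat A1 A2 A3 A4 = four_block_mat A1 A2 (0\<^sub>m k s) (0\<^sub>m k k)"
    "transpose_mat (projE s k * four_block_mat A1 A2 A3 A4) = four_block_mat (transpose_mat A1) (0\<^sub>m s k) (transpose_mat A2) (0\<^sub>m k k)"
    if "A1 \<in> carrier_mat s s" "A2 \<in> carrier_mat s k" "A3 \<in> carrier_mat k s" "A4 \<in> carrier_mat k k" for A1 A2 A3 A4 :: "'a mat"
    using that by (simp_all add: proj_mult transpose_four_block_mat[of _ s s _ k _ k])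
  {
    fix A :: "'a mat" assume "A \<in> {A \<in> GL (s + k). transpose_mat (projE s k * A) = projE s k * A}"
    then have A: "A \<in> GL (s + k)" "transpose_mat (projE s k * A) = projE s k * A" by auto
    define A1 A2 A3 A4 where A_def: "A1 = blk A 0 0 s s" "A2 = blk A 0 s s k" "A3 = blk A s 0 k s" "A4 = blk A s s k k"
    have ca: "A1 \<in> carrier_mat s s" "A2 \<in> carrier_mat s k" "A3 \<in> carrier_mat k s" "A4 \<in> carrier_mat k k" by (simp_all add: A_def)
    have Aeq: "A = four_block_mat A1 A2 A3 A4" using four_block_blk[OF GL_carrier[OF A(1)]] by (simp add: A_def)
    have "four_block_mat (transpose_mat A1) (0\<^sub>m s k) (transpose_mat A2) (0\<^sub>m k k) = four_block_mat A1 A2 (0\<^sub>m k s) (0\<^sub>m k k)"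
      by (simp only: E(2)[OF ca, symmetric] E(1)[OF ca, symmetric] Aeq[symmetric] A(2))
    then have "transpose_mat A1 = A1" "A2 = 0\<^sub>m s k"
      using ca by (auto simp: four_block_eq_iff[of _ s s _ k _ k])
    then have Al: "A = lower_tri s k A1 A3 A4" and "transpose_mat A1 = A1" by (auto simp: Aeq lower_tri_def)
    moreover from Al have "A1 \<in> GL s" "A4 \<in> GL k" using A(1) lower_tri_GL_iff[OF ca(1,3,4)] by auto
    ultimately show "A \<in> (\<lambda>(A1, A3, A4). lower_tri s k A1 A3 A4) ` (SymGL s \<times> carrier_mat k s \<times> GL k)"
      using ca by (intro image_eqI[where x = "(A1, A3, A4)"]) (auto simp: SymGL_def)
  next
    fix A :: "'a mat" assume "A \<in> (\<lambda>(A1, A3, A4). lower_tri s k A1 A3 A4) ` (SymGL s \<times> carrier_mat k s \<times> GL k)"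
    then obtain A1 A3 A4 where A: "A1 \<in> GL s" "transpose_mat A1 = A1" "A3 \<in> carrier_mat k s" "A4 \<in> GL k" "A = lower_tri s k A1 A3 A4"
      by (auto simp: SymGL_def)
    note c = GL_carrier[OF A(1)] GL_carrier[OF A(4)]
    have "A \<in> GL (s + k)" using A c by (simp add: lower_tri_GL_iff)
    moreover have "transpose_mat (projE s k * A) = projE s k * A"
      using A(2,3) c unfolding A(5) lower_tri_def by (subst E(2), simp_all) (subst E(1), simp_all)
    ultimately show "A \<in> {A \<in> GL (s + k). transpose_mat (projE s k * A) = projE s k * A}" by simp
  }
qed

lemma mat_trace_projD_lower_tri:
  fixes A1 A3 A4 :: "'a::field mat"
  assumes "A1 \<in> GL s" "A3 \<in> carrier_mat k s" "A4 \<in> GL k"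
  shows "mat_trace (projD s k * lower_tri s k A1 A3 A4) = mat_trace A4"
    and "mat_trace (projD s k * transpose_mat (mat_inv (lower_tri s k A1 A3 A4))) = mat_trace (mat_inv A4)"
proof -
  note c = GL_carrier[OF assms(1)] GL_carrier[OF assms(3)] mat_inv(1)[OF assms(1)] mat_inv(1)[OF assms(3)]
  have z: "mat_trace (0\<^sub>m s s) = (0 :: 'a)" by (simp add: mat_trace_def)
  show "mat_trace (projD s k * lower_tri s k A1 A3 A4) = mat_trace A4"
    using c assms(2) z by (simp add: lower_tri_def proj_mult mat_trace_four_block[of _ s _ k])
  obtain Z where Z: "Z \<in> carrier_mat k s" "mat_inv (lower_tri s k A1 A3 A4) = lower_tri s k (mat_inv A1) Z (mat_inv A4)"
    by (rule mat_inv_lower_tri[OF assms])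
  have "transpose_mat (lower_tri s k (mat_inv A1) Z (mat_inv A4)) =
    four_block_mat (transpose_mat (mat_inv A1)) (transpose_mat Z) (0\<^sub>m k s) (transpose_mat (mat_inv A4))"
    using c Z(1) by (simp add: lower_tri_def transpose_four_block_mat[of _ s s _ k _ k])
  then show "mat_trace (projD s k * transpose_mat (mat_inv (lower_tri s k A1 A3 A4))) = mat_trace (mat_inv A4)"
    using c Z z by (simp add: proj_mult mat_trace_four_block[of _ s _ k] mat_trace_transpose[of _ k])
qed

text \<open>The four factors come from the sum over B, the symmetric block A1, the free block A3,
  and A4: on a lower triangular A the two remaining traces are those of A4 and of its
  inverse.\<close>

lemma sum_sigma_P_plus:
  fixes \<psi> :: "'a::{field,finite} \<Rightarrow> complex"
  assumes c2: "(1 :: 'a) + 1 = 0" and \<psi>: "nontrivial_additive_character \<psi>"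
  shows "(\<Sum>p\<in>P_plus (s + k). \<psi> (mat_trace (sigma_plus (s + k) s * p))) =
    of_nat (card (Alt (s + k) :: 'a mat set)) * of_nat (card (SymGL s :: 'a mat set)) *
    of_nat (card (UNIV :: 'a set)) ^ (s * k) * kloosterman_GL k \<psi> 1"
proof -
  let ?n = "s + k" and ?E = "projE s k :: 'a mat" and ?D = "projD s k :: 'a mat"
  note add = additive_character[OF \<psi>]
  define f where "f A = \<psi> (mat_trace (?D * A) + mat_trace (?D * transpose_mat (mat_inv A)))" for A
  have "(\<Sum>p\<in>P_plus ?n. \<psi> (mat_trace (sigma_plus ?n s * p)))
      = (\<Sum>(A, B)\<in>GL ?n \<times> Alt ?n. \<psi> (mat_trace (sigma_plus ?n s * parabolic ?n A B)))"
    unfolding P_plus_eq by (subst sum.reindex[OF inj_on_parabolic]) (simp add: split_def)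
  also have "\<dots> = (\<Sum>(A, B)\<in>GL ?n \<times> Alt ?n. f A * \<psi> (mat_trace (?E * A * B)))"
    by (intro sum.cong) (auto simp: mat_trace_sigma_parabolic f_def add(1))
  also have "\<dots> = (\<Sum>A\<in>GL ?n. f A * (\<Sum>B\<in>Alt ?n. \<psi> (mat_trace (?E * A * B))))"
    by (simp add: sum.cartesian_product[symmetric] sum_distrib_left)
  also have "\<dots> = (\<Sum>A\<in>GL ?n. if transpose_mat (?E * A) = ?E * A then f A * of_nat (card (Alt ?n :: 'a mat set)) else 0)"
  proof (rule sum.cong[OF refl])
    fix A :: "'a mat" assume "A \<in> GL ?n"
    then have "?E * A \<in> carrier_mat ?n ?n" by (intro mult_carrier_mat[OF proj_carrier(1)] GL_carrier)
    then show "f A * (\<Sum>B\<in>Alt ?n. \<psi> (mat_trace (?E * A * B)))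
        = (if transpose_mat (?E * A) = ?E * A then f A * of_nat (card (Alt ?n :: 'a mat set)) else 0)"
      by (simp add: sum_character_Alt[OF c2 \<psi>])
  qed
  also have "\<dots> = (\<Sum>A\<in>{A \<in> GL ?n. transpose_mat (?E * A) = ?E * A}. f A) * of_nat (card (Alt ?n :: 'a mat set))"
    by (simp add: sum.inter_filter[symmetric] finite_GL sum_distrib_right)
  also have "(\<Sum>A\<in>{A \<in> GL ?n. transpose_mat (?E * A) = ?E * A}. f A)
      = (\<Sum>(A1, A3, A4)\<in>SymGL s \<times> carrier_mat k s \<times> GL k. f (lower_tri s k A1 A3 A4))"
  proof -
    have "inj_on (\<lambda>(A1, A3, A4). lower_tri s k A1 A3 A4) (SymGL s \<times> carrier_mat k s \<times> (GL k :: 'a mat set))"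
      by (rule inj_on_lower_tri) (auto simp: SymGL_def)
    then show ?thesis
      unfolding projE_mult_symmetric by (subst sum.reindex) (simp_all add: split_def)
  qed
  also have "\<dots> = (\<Sum>(A1, A3, A4)\<in>(SymGL s :: 'a mat set) \<times> (carrier_mat k s :: 'a mat set) \<times> GL k. \<psi> (mat_trace A4 + 1 * mat_trace (mat_inv A4)))"
    by (intro sum.cong) (auto simp: f_def mat_trace_projD_lower_tri SymGL_def)
  also have "\<dots> = of_nat (card (SymGL s :: 'a mat set)) * (of_nat (card (carrier_mat k s :: 'a mat set)) * kloosterman_GL k \<psi> 1)"
    by (simp add: sum.cartesian_product[symmetric] kloosterman_GL_def)
  finally show ?thesis by (simp add: card_carrier_mat mult.commute)
qed

text \<open>The factor \<open>g\<close> stands for the Gaussian binomial, so that one computation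
  serves k = 1 and k = 2. In the exponent, s * k comes from the free block of A, the sum over j < s
  from the index of the stabiliser, and the sum over j < s + k from the alternating
  matrices.\<close>

lemma sum_P_double_coset:
  fixes \<psi> :: "'a::{field,finite} \<Rightarrow> complex"
  defines "q \<equiv> card (UNIV :: 'a set)"
  assumes c2: "(1 :: 'a) + 1 = 0" and \<psi>: "nontrivial_additive_character \<psi>"
    and g: "real (card (GL (s + k) :: 'a mat set)) =
      g * real q ^ (s * k) * real (card (GL s :: 'a mat set)) * real (card (GL k :: 'a mat set))"
  shows "(\<Sum>w\<in>P_double_coset (s + k) s. \<psi> (mat_trace w)) =
    complex_of_real (g * real q ^ (s * k + (\<Sum>j<s. j) + (\<Sum>j<s + k. j)) * real (card (SymGL s :: 'a mat set))) *
    kloosterman_GL k \<psi> 1"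
proof -
  let ?n = "s + k" and ?\<sigma> = "sigma_plus (s + k) s :: 'a mat" and ?N = "s + k + (s + k)"
  let ?S = "\<Sum>w\<in>P_double_coset (s + k) s. \<psi> (mat_trace w)" and ?K = "kloosterman_GL k \<psi> 1"
  let ?G = "GL_group ?N :: 'a mat monoid"
  interpret group ?G by (rule group_GL)
  have mult: "x \<otimes>\<^bsub>?G\<^esub> y = x * y" for x y :: "'a mat" by (simp add: GL_group_def)
  have inv: "inv\<^bsub>?G\<^esub> ?\<sigma> = ?\<sigma>"
    using mat_inv_unique[OF sigma_plus_carrier sigma_plus_carrier sigma_plus_square] by (simp add: inv_GL_group[OF sigma_plus_GL])
  have comm: "\<psi> (mat_trace (x * y)) = \<psi> (mat_trace (y * x))" if "x \<in> carrier ?G" "y \<in> carrier ?G" for x y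
    using that mat_trace_comm[of x ?N ?N y] by (simp add: GL_group_def GL_carrier)
  define LT :: "'a mat set" where "LT = (\<lambda>(A1, A3, A4). lower_tri s k A1 A3 A4) ` (GL s \<times> carrier_mat k s \<times> GL k)"
  define H where "H = {h \<in> P_plus ?n. ?\<sigma> * h * ?\<sigma> \<in> P_plus ?n}"
  have "of_nat (card H) * ?S = of_nat (card (P_plus ?n :: 'a mat set)) * (\<Sum>p\<in>P_plus ?n. \<psi> (mat_trace (?\<sigma> * p)))"
  proof -
    have "P_double_coset ?n s = (\<lambda>(p, p'). p * ?\<sigma> * p') ` (P_plus ?n \<times> P_plus ?n)"
      unfolding P_double_coset_def by auto
    then show ?thesis
      using sum_double_coset[OF subgroup_P_plus[OF c2, of ?n], of ?\<sigma> "\<lambda>w. \<psi> (mat_trace w)"] sigma_plus_GL[of s k] comm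
      by (simp add: mult inv H_def) (simp add: GL_group_def)
  qed
  moreover have "card H = card (GL s :: 'a mat set) * (q ^ (s * k) * card (GL k :: 'a mat set)) * card (AltZ ?n s :: 'a mat set)"
  proof -
    have "LT \<times> AltZ ?n s \<subseteq> GL ?n \<times> Alt ?n"
      unfolding LT_def by (rule Sigma_mono) (auto simp: AltZ_def lower_tri_GL_iff GL_carrier)
    then have "inj_on (\<lambda>(A, B). parabolic ?n A B) (LT \<times> AltZ ?n s)"
      by (rule inj_on_subset[OF inj_on_parabolic])
    then have "card H = card LT * card (AltZ ?n s :: 'a mat set)"
      unfolding H_def P_plus_conj_sigma[OF c2] LT_def by (simp add: card_image card_cartesian_product)
    moreover have "card LT = card (GL s :: 'a mat set) * (q ^ (s * k) * card (GL k :: 'a mat set))"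
      unfolding LT_def by (subst card_image[OF inj_on_lower_tri])
        (simp_all add: card_cartesian_product card_carrier_mat q_def mult.commute)
    ultimately show ?thesis by simp
  qed
  moreover have "card (P_plus ?n :: 'a mat set) = card (GL ?n :: 'a mat set) * (q ^ (\<Sum>j<s. j) * card (AltZ ?n s :: 'a mat set))"
    unfolding P_plus_eq by (simp add: card_image[OF inj_on_parabolic] card_cartesian_product card_Alt_AltZ[of s ?n] q_def)
  moreover have "(of_nat (card (GL ?n :: 'a mat set)) :: complex) =
      of_real g * of_nat q ^ (s * k) * of_nat (card (GL s :: 'a mat set)) * of_nat (card (GL k :: 'a mat set))"
    using arg_cong[OF g, of complex_of_real] by simp
  ultimately have eq: "of_nat (card (GL s :: 'a mat set)) * (of_nat q ^ (s * k) * of_nat (card (GL k :: 'a mat set))) *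
      of_nat (card (AltZ ?n s :: 'a mat set)) * ?S =
      of_real g * of_nat q ^ (s * k) * of_nat (card (GL s :: 'a mat set)) * of_nat (card (GL k :: 'a mat set)) *
      (of_nat q ^ (\<Sum>j<s. j) * of_nat (card (AltZ ?n s :: 'a mat set))) *
      (of_nat q ^ (\<Sum>j<?n. j) * of_nat (card (SymGL s :: 'a mat set)) * of_nat q ^ (s * k) * ?K)"
    by (simp add: sum_sigma_P_plus[OF c2 \<psi>] card_Alt q_def)
  have ne: "(of_nat (card (GL m :: 'a mat set)) :: complex) \<noteq> 0" for m
    using one_GL[of m, where 'a = 'a] finite_GL[of m, where 'a = 'a] by auto
  have "q > 1" unfolding q_def by (rule card_field_gt_1)
  then have q: "(of_nat q :: complex) \<noteq> 0" by simp
  have "(of_nat (card (AltZ ?n s :: 'a mat set)) :: complex) \<noteq> 0"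
    using card_AltZ[of s ?n, where 'a = 'a] q by (simp add: q_def)
  \<comment> \<open>The orders of both linear groups, the order of \<open>AltZ\<close> and one
    factor q^(s * k) cancel against the stabiliser.\<close>
  then have "?S = of_real g * of_nat q ^ (\<Sum>j<s. j) * (of_nat q ^ (\<Sum>j<?n. j) * of_nat (card (SymGL s :: 'a mat set)) * of_nat q ^ (s * k) * ?K)"
    using eq ne[of s] ne[of k] q by (simp add: ac_simps)
  then show ?thesis by (simp add: power_add ac_simps)
qed

section \<open>Characteristic 2 and the final exponents\<close>

lemma char_2_if_card_eq_power_2:
  assumes "card (UNIV :: 'a::{field,finite} set) = 2 ^ r"
  shows "(1 :: 'a) + 1 = 0"
proof -
  \<comment> \<open>Translation by 1 permutes the field, so adding 1 to every summand leaves the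
    total unchanged and the number of elements is zero in the field.\<close>
  have "(\<Sum>x\<in>UNIV. x) = (\<Sum>x\<in>UNIV. x + (1 :: 'a))"
    by (rule sum.reindex_bij_witness[of _ "\<lambda>x. x + 1" "\<lambda>x. x - 1"]) auto
  then have "of_nat (card (UNIV :: 'a set)) = (0 :: 'a)" by (simp add: sum.distrib)
  then have "(2 :: 'a) ^ r = 0" by (simp add: assms)
  then show ?thesis by simp
qed

lemma real_sum_lessThan: "real (\<Sum>j<n. j) = real n * (real n - 1) / 2"
  by (induction n) (simp_all add: field_simps)

theorem theorem4:
  fixes \<psi> :: "'a::{field,finite} \<Rightarrow> complex" and q r n :: nat
  assumes "q = 2 ^ r"
    and "card (UNIV :: 'a set) = q"
    and "nontrivial_additive_character \<psi>"
  shows "(even n \<and> n \<ge> 2 \<longrightarrow>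
           (\<Sum>w\<in>DC1_plus n. \<psi> (mat_trace w)) = complex_of_real (A1_plus n q) * kloosterman \<psi> 1) \<and>
         (odd n \<and> n \<ge> 1 \<longrightarrow>
           (\<Sum>w\<in>DC1_minus n. \<psi> (mat_trace w)) = complex_of_real (A1_minus n q) * kloosterman \<psi> 1) \<and>
         (even n \<and> n \<ge> 2 \<longrightarrow>
           (\<Sum>w\<in>DC2_plus n. \<psi> (mat_trace w)) =
             inverse (of_nat q) * complex_of_real (A2_plus n q) * kloosterman_GL 2 \<psi> 1 \<and>
           inverse (of_nat q) * complex_of_real (A2_plus n q) * kloosterman_GL 2 \<psi> 1 =
             complex_of_real (A2_plus n q) * (kloosterman \<psi> 1 ^ 2 + of_nat q ^ 2 - of_nat q)) \<and>
         (odd n \<and> n \<ge> 3 \<longrightarrow>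
           (\<Sum>w\<in>DC2_minus n. \<psi> (mat_trace w)) =
             inverse (of_nat q) * complex_of_real (A2_minus n q) * kloosterman_GL 2 \<psi> 1 \<and>
           inverse (of_nat q) * complex_of_real (A2_minus n q) * kloosterman_GL 2 \<psi> 1 =
             complex_of_real (A2_minus n q) * (kloosterman \<psi> 1 ^ 2 + of_nat q ^ 2 - of_nat q))"
proof -
  note \<psi> = assms(3)
  have c2: "(1 :: 'a) + 1 = 0" by (rule char_2_if_card_eq_power_2[of r]) (simp add: assms(1,2))
  have q: "q > 1" using card_field_gt_1[where 'a = 'a] assms(2) by simp
  then have q0: "real q > 0" by simp
  have pw: "real q powr x = real q ^ e" if "x = real e" for x e
    using q0 that by (simp add: powr_realpow)
  have K2: "inverse (of_nat q) * complex_of_real x * kloosterman_GL 2 \<psi> 1 =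
      complex_of_real x * (kloosterman \<psi> 1 ^ 2 + of_nat q ^ 2 - of_nat q)" for x
    using q by (simp add: kloosterman_GL_2[OF \<psi>] assms(2))
  note sym = card_SymGL[where 'a = 'a, unfolded assms(2)]
  \<comment> \<open>q^e * R is the closed form of \<open>card_SymGL\<close>, with its two shapes for
    even and odd s. The other exponents add up to s + s(s-1)/2 + s(s+1)/2 = s^2 + s.\<close>
  have DC1: "(\<Sum>w\<in>P_double_coset n (n - 1). \<psi> (mat_trace w)) =
      complex_of_real (real q powr y * gauss_binomial q n 1 * R) * kloosterman \<psi> 1"
    if n: "n = s + 1" and S: "real (card (SymGL s :: 'a mat set)) = real q ^ e * R"
      and y: "y = real s ^ 2 + real s + real e" for s e y R
  proof -
    define d where "d = s * 1 + (\<Sum>j<s. j) + (\<Sum>j<s + 1. j)"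
    have "real d = real s ^ 2 + real s"
      unfolding d_def of_nat_add real_sum_lessThan by (simp add: field_simps power2_eq_square)
    then have "y = real (d + e)" by (simp only: y of_nat_add)
    then have "real q powr y = real q ^ (d + e)" by (rule pw)
    then have "gauss_binomial q (s + 1) 1 * real q ^ d * real (card (SymGL s :: 'a mat set)) =
        real q powr y * gauss_binomial q (s + 1) 1 * R"
      by (simp add: S power_add)
    moreover have "(\<Sum>w\<in>P_double_coset (s + 1) s. \<psi> (mat_trace w)) =
        complex_of_real (gauss_binomial q (s + 1) 1 * real q ^ d * real (card (SymGL s :: 'a mat set))) * kloosterman \<psi> 1"
      using sum_P_double_coset[OF c2 \<psi> card_GL_gauss_binomial_1[of s]] unfolding kloosterman_GL_1 assms(2) d_def .
    ultimately show ?thesis by (simp only: n add_diff_cancel_right')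
  qed
  \<comment> \<open>For k = 2 the exponents other than e add up to s^2 + 3s + 1; y exceeds this by
    one because the claim carries the factor 1/q.\<close>
  have DC2: "(\<Sum>w\<in>P_double_coset n (n - 2). \<psi> (mat_trace w)) =
      inverse (of_nat q) * complex_of_real (real q powr y * gauss_binomial q n 2 * R) * kloosterman_GL 2 \<psi> 1"
    if n: "n = s + 2" and S: "real (card (SymGL s :: 'a mat set)) = real q ^ e * R"
      and y: "y = real s ^ 2 + 3 * real s + 2 + real e" for s e y R
  proof -
    define d where "d = s * 2 + (\<Sum>j<s. j) + (\<Sum>j<s + 2. j)"
    have "real d = real s ^ 2 + 3 * real s + 1"
      unfolding d_def of_nat_add real_sum_lessThan by (simp add: field_simps power2_eq_square)
    then have "y = real (Suc (d + e))" by (simp only: y of_nat_add of_nat_Suc)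
    then have "real q powr y = real q ^ Suc (d + e)" by (rule pw)
    then have "inverse (real q) * (real q powr y * gauss_binomial q (s + 2) 2 * R) =
        gauss_binomial q (s + 2) 2 * real q ^ d * (real q ^ e * R)"
      using q0 by (simp only: power_Suc power_add[of _ d e]) (simp add: field_simps)
    then have "gauss_binomial q (s + 2) 2 * real q ^ d * real (card (SymGL s :: 'a mat set)) =
        inverse (real q) * (real q powr y * gauss_binomial q (s + 2) 2 * R)" by (simp only: S)
    moreover have "(\<Sum>w\<in>P_double_coset (s + 2) s. \<psi> (mat_trace w)) =
        complex_of_real (gauss_binomial q (s + 2) 2 * real q ^ d * real (card (SymGL s :: 'a mat set))) * kloosterman_GL 2 \<psi> 1"
      using sum_P_double_coset[OF c2 \<psi> card_GL_gauss_binomial_2[of s]] unfolding assms(2) d_def .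
    ultimately show ?thesis
      by (simp only: n add_diff_cancel_right' of_real_mult[of "inverse (real q)"] of_real_inverse of_real_of_nat_eq)
  qed
  have "(\<Sum>w\<in>DC1_plus n. \<psi> (mat_trace w)) = complex_of_real (A1_plus n q) * kloosterman \<psi> 1" if n: "even n" "n \<ge> 2"
  proof -
    obtain t where "n = 2 * t" using n(1) by (elim evenE)
    \<comment> \<open>s = n - 1 = 2m + 1 is odd, so the product in the odd count runs up to m + 1 =
      n/2.\<close>
    then obtain m where m: "n = 2 * m + 1 + 1" using n(2) by (cases t) auto
    have d: "n div 2 = m + 1" by (simp add: m)
    show ?thesis unfolding DC1_plus_def A1_plus_def d
      by (rule DC1[OF m sym(2)]) (simp add: m field_simps power2_eq_square)
  qed
  moreover have "(\<Sum>w\<in>DC1_minus n. \<psi> (mat_trace w)) = complex_of_real (A1_minus n q) * kloosterman \<psi> 1" if n: "odd n"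
  proof -
    obtain m where m: "n = 2 * m + 1" using n by (elim oddE)
    have d: "(n - 1) div 2 = m" by (simp add: m)
    show ?thesis unfolding DC1_minus_def A1_minus_def d
      by (rule DC1[OF m sym(1)]) (simp add: m field_simps power2_eq_square)
  qed
  moreover have "(\<Sum>w\<in>DC2_plus n. \<psi> (mat_trace w)) =
      inverse (of_nat q) * complex_of_real (A2_plus n q) * kloosterman_GL 2 \<psi> 1" if n: "even n" "n \<ge> 2"
  proof -
    obtain t where "n = 2 * t" using n(1) by (elim evenE)
    then obtain m where m: "n = 2 * m + 2" using n(2) by (cases t) auto
    have d: "(n - 2) div 2 = m" by (simp add: m)
    show ?thesis unfolding DC2_plus_def A2_plus_def d
      by (rule DC2[OF m sym(1)]) (simp add: m field_simps power2_eq_square)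
  qed
  moreover have "(\<Sum>w\<in>DC2_minus n. \<psi> (mat_trace w)) =
      inverse (of_nat q) * complex_of_real (A2_minus n q) * kloosterman_GL 2 \<psi> 1" if n: "odd n" "n \<ge> 3"
  proof -
    obtain t where "n = 2 * t + 1" using n(1) by (elim oddE)
    \<comment> \<open>s = n - 2 is odd, so the product runs up to m + 1 = (n - 1)/2, not (n -
      3)/2.\<close>
    then obtain m where m: "n = 2 * m + 1 + 2" using n(2) by (cases t) auto
    have d: "(n - 1) div 2 = m + 1" by (simp add: m)
    show ?thesis unfolding DC2_minus_def A2_minus_def d
      by (rule DC2[OF m sym(2)]) (simp add: m field_simps power2_eq_square)
  qed
  ultimately show ?thesis using K2 by blast
qed

end
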